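(* Let $p$ be a rational prime with $p\equiv 7$ or $9 \pmod{16}$, and let $n$ be an integer with $n\ge 3$ if $p\equiv 7\pmod{16}$ and $n\ge 2$ if $p\equiv 9\pmod{16}$. Let $\mathfrak{p}$ be a prime ideal of $\mathbb{Z}[\zeta_{2^{n+1}}]$ lying over $p$. Let $(a_p,b_p)$ be the solution of $a^2-2b^2=p$ in positive integers with $a_p$ minimal. Then $$\lambda_1\big(\Sigma_{\mathbb{Q}(\zeta_{2^{n+1}})}(\mathfrak{p})\big)=\sqrt{2^n a_p}.$$ Moreover, $\lambda_1\big(\Sigma_{\mathbb{Q}(\zeta_{2^{n+1}})}(\mathfrak{p})\big)$ is bounded above by $\sqrt[4]{2^{2n+1}p}$, and $\sqrt[4]{2^{2n+1}p}<2^n\sqrt[4]{p}$ (the latter being the upper bound given by Minkowski's theorem).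
   Context: $\zeta_m=e^{2\pi i/m}$. For a number field $\mathbb{K}$ of degree $t$ with complex embeddings $\varphi_1,\dots,\varphi_t$ (all of them, including both members of each complex-conjugate pair), the canonical embedding is $\Sigma_{\mathbb{K}}(x)=(\varphi_1(x),\dots,\varphi_t(x))$ with Euclidean norm $\|\Sigma_{\mathbb{K}}(x)\|^2=\sum_{j=1}^t|\varphi_j(x)|^2$. For a nonzero ideal $I$ of the ring of integers, $\lambda_1(\Sigma_{\mathbb{K}}(I))=\min_{0\ne x\in I}\|\Sigma_{\mathbb{K}}(x)\|$ is the length of a shortest nonzero vector of the ideal lattice. *)

theory Defs
  imports Complex_Main "HOL-Computational_Algebra.Polynomial"
begin

definition zeta :: "nat \<Rightarrow> complex" where
  "zeta m = cis (2 * pi / real m)"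

definition cyc_int :: "nat \<Rightarrow> complex set" where
  "cyc_int m = {poly (map_poly of_int f) (zeta m) | f :: int poly. True}"

text \<open>The complex embeddings of Q(zeta_m): for 1 <= k < m with gcd(k,m)=1,
  phi_k sends zeta_m to zeta_m^k. On an element written as an integer
  polynomial in zeta_m it acts by evaluating the polynomial at zeta_m^k.\<close>
definition cyc_emb :: "nat \<Rightarrow> nat \<Rightarrow> complex \<Rightarrow> complex" where
  "cyc_emb m k x = (THE y. \<exists>f :: int poly. x = poly (map_poly of_int f) (zeta m)
                                     \<and> y = poly (map_poly of_int f) (zeta m ^ k))"

definition cyc_emb_index :: "nat \<Rightarrow> nat set" where
  "cyc_emb_index m = {k. 1 \<le> k \<and> k < m \<and> coprime k m}"

definition canon_norm :: "nat \<Rightarrow> complex \<Rightarrow> real" where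
  "canon_norm m x = sqrt (\<Sum>k\<in>cyc_emb_index m. (cmod (cyc_emb m k x))\<^sup>2)"

definition cyc_ideal :: "nat \<Rightarrow> complex set \<Rightarrow> bool" where
  "cyc_ideal m I \<longleftrightarrow> I \<subseteq> cyc_int m \<and> 0 \<in> I
     \<and> (\<forall>x\<in>I. \<forall>y\<in>I. x + y \<in> I \<and> - x \<in> I)
     \<and> (\<forall>r\<in>cyc_int m. \<forall>x\<in>I. r * x \<in> I)"

definition cyc_prime_ideal :: "nat \<Rightarrow> complex set \<Rightarrow> bool" where
  "cyc_prime_ideal m P \<longleftrightarrow> cyc_ideal m P \<and> P \<noteq> cyc_int m
     \<and> (\<forall>a\<in>cyc_int m. \<forall>b\<in>cyc_int m. a * b \<in> P \<longrightarrow> a \<in> P \<or> b \<in> P)"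

text \<open>A prime ideal P lies over the rational prime p iff P \<inter> Z = pZ,
  equivalently (P being proper and prime) p \<in> P.\<close>
definition lies_over :: "nat \<Rightarrow> complex set \<Rightarrow> int \<Rightarrow> bool" where
  "lies_over m P p \<longleftrightarrow> cyc_prime_ideal m P \<and> of_int p \<in> P"

definition lambda1 :: "nat \<Rightarrow> complex set \<Rightarrow> real" where
  "lambda1 m I = Inf (canon_norm m ` (I - {0}))"

definition a_p :: "int \<Rightarrow> int" where
  "a_p p = (LEAST a. a > 0 \<and> (\<exists>b::int. b > 0 \<and> a\<^sup>2 - 2 * b\<^sup>2 = p))"

end

theory Submission
  imports
    Defs
    "HOL-Analysis.Analysis"
    "HOL-Computational_Algebra.Computational_Algebra"
    "HOL-Number_Theory.Cong"
    "HOL-Library.Z2"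
begin

text \<open>
  Write \<open>N = 2\<^sup>n\<close> and \<open>x = \<Sum>\<^bsub>i<N\<^esub> c\<^sub>i \<zeta>\<^sup>i\<close>; since \<open>X\<^sup>N + 1\<close> is irreducible, the squared length
  of \<open>x\<close> is \<open>N \<Sum> c\<^sub>i\<^sup>2\<close>. Put \<open>A = \<Sum> c\<^sub>i\<^sup>2\<close> and \<open>B = \<Sum> c\<^sub>i c\<^bsub>i+N/4\<^esub>\<close> (indices negacyclic), so that
  \<open>A + B \<surd>2\<close> is the normalised trace of \<open>x x\<^sup>*\<close> to \<open>\<rat>(\<surd>2)\<close>.

  Lower bound: \<open>P\<close> is stable under Frobenius \<open>\<zeta> \<mapsto> \<zeta>\<^sup>p\<close>, and suitable powers of Frobenius act on
  \<open>2\<close>-power roots of unity by a sign. Hence \<open>x \<in> P\<close> splits into short blocks lying in \<open>P\<close>, for which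
  \<open>A + B \<surd>2 \<in> P\<close> is a direct computation. So \<open>p\<close> divides \<open>A\<^sup>2 - 2 B\<^sup>2 > 0\<close>, and either
  this equals \<open>p\<close>, giving \<open>A \<ge> a\<^sub>p\<close>, or \<open>A\<^sup>2 \<ge> 2 p \<ge> a\<^sub>p\<^sup>2\<close>.

  Upper bound: \<open>P\<close> contains an element of the quartic decomposition field (\<open>\<rat>(\<zeta>\<^sub>8)\<close>, respectively the
  subfield of \<open>\<rat>(\<zeta>\<^sub>1\<^sub>6)\<close> fixed by \<open>\<zeta> \<mapsto> \<zeta>\<^sup>7\<close>) with \<open>A\<^sup>2 - 2 B\<^sup>2 = k p\<close> and \<open>k\<close> small by
  Minkowski's theorem; the few cases \<open>k > 1\<close> are impossible or reduce to \<open>k = 1\<close> by division by an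
  element of norm \<open>2\<close> or \<open>7\<close>. Multiplying by powers of the unit \<open>1 + \<surd>2\<close> then brings \<open>A\<close> down to \<open>a\<^sub>p\<close>.
\<close>


section \<open>Prime ideals above a rational prime and the Frobenius map\<close>

text \<open>The ring is a subset \<open>R\<close> of a type, so that the locale can be interpreted
  with \<open>cyc_int\<close> inside the complex numbers.\<close>

locale prime_ideal_over =
  fixes R P :: "'a :: comm_ring_1 set" and p :: nat
  assumes one_R: "1 \<in> R"
    and add_R: "x \<in> R \<Longrightarrow> y \<in> R \<Longrightarrow> x + y \<in> R"
    and uminus_R: "x \<in> R \<Longrightarrow> - x \<in> R"
    and mult_R: "x \<in> R \<Longrightarrow> y \<in> R \<Longrightarrow> x * y \<in> R"
    and P_subset: "P \<subseteq> R"
    and zero_P: "0 \<in> P"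
    and add_P: "x \<in> P \<Longrightarrow> y \<in> P \<Longrightarrow> x + y \<in> P"
    and mult_P: "x \<in> R \<Longrightarrow> y \<in> P \<Longrightarrow> x * y \<in> P"
    and one_notin_P: "1 \<notin> P"
    and prime_P: "x \<in> R \<Longrightarrow> y \<in> R \<Longrightarrow> x * y \<in> P \<Longrightarrow> x \<in> P \<or> y \<in> P"
    and prime_p: "prime p"
    and p_in_P: "of_nat p \<in> P"
begin

lemma P_R: "x \<in> P \<Longrightarrow> x \<in> R"
  using P_subset by blast

lemma uminus_P: "x \<in> P \<Longrightarrow> - x \<in> P"
  using mult_P[OF uminus_R[OF one_R], of x] by simp

lemma diff_P: "x \<in> P \<Longrightarrow> y \<in> P \<Longrightarrow> x - y \<in> P"
  using add_P[of x "- y"] uminus_P[of y] by simp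

lemma diff_R: "x \<in> R \<Longrightarrow> y \<in> R \<Longrightarrow> x - y \<in> R"
  using add_R[of x "- y"] uminus_R[of y] by simp

lemma mult_P_right: "x \<in> P \<Longrightarrow> y \<in> R \<Longrightarrow> x * y \<in> P"
  using mult_P[of y x] by (simp add: mult.commute)

lemma zero_R: "0 \<in> R"
  using zero_P P_R by blast

lemma power_R: "x \<in> R \<Longrightarrow> x ^ k \<in> R"
  by (induction k) (auto simp: one_R mult_R)

lemma of_nat_R: "of_nat k \<in> R"
  by (induction k) (auto simp: one_R zero_R add_R)

lemma of_int_R: "of_int k \<in> R"
  by (cases k) (auto simp: of_nat_R uminus_R one_R add_R diff_R simp del: of_nat_Suc)

lemma sum_R: "(\<And>i. i \<in> I \<Longrightarrow> f i \<in> R) \<Longrightarrow> sum f I \<in> R"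
  by (induction I rule: infinite_finite_induct) (auto simp: zero_R add_R)

lemma prod_R: "(\<And>i. i \<in> I \<Longrightarrow> f i \<in> R) \<Longrightarrow> prod f I \<in> R"
  by (induction I rule: infinite_finite_induct) (auto simp: one_R mult_R)

lemma sum_P: "(\<And>i. i \<in> I \<Longrightarrow> f i \<in> P) \<Longrightarrow> sum f I \<in> P"
  by (induction I rule: infinite_finite_induct) (auto simp: zero_P add_P)

lemmas closed_R = one_R zero_R add_R uminus_R diff_R mult_R power_R of_int_R of_nat_R sum_R

lemma unit_notin_P: "x \<in> R \<Longrightarrow> y \<in> R \<Longrightarrow> x * y = 1 \<Longrightarrow> x \<notin> P"
  using mult_P_right one_notin_P by metis

lemma prod_in_P: "finite I \<Longrightarrow> (\<And>i. i \<in> I \<Longrightarrow> f i \<in> R) \<Longrightarrow> prod f I \<in> P \<Longrightarrow> \<exists>i\<in>I. f i \<in> P"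
proof (induction I rule: finite_induct)
  case empty
  then show ?case using one_notin_P by simp
next
  case (insert i I)
  then show ?case using prime_P[of "f i" "prod f I"] by (auto simp: prod_R)
qed

text \<open>An integer prime to \<open>p\<close> lying in \<open>P\<close> would put 1 into
  \<open>P\<close> by Bezout.\<close>

lemma of_int_in_P_iff: "of_int k \<in> P \<longleftrightarrow> int p dvd k"
proof
  assume k: "of_int k \<in> P"
  show "int p dvd k"
  proof (rule ccontr)
    assume "\<not> int p dvd k"
    then have "coprime (int p) k"
      using prime_p by (intro prime_imp_coprime) auto
    then obtain u v where uv: "u * int p + v * k = 1"
      using bezout_int[of "int p" k] by (auto simp: coprime_iff_gcd_eq_1)
    have "of_int u * of_nat p + of_int v * of_int k \<in> P"
      by (intro add_P mult_P of_int_R k p_in_P)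
    also have "of_int u * of_nat p + of_int v * of_int k = (of_int (u * int p + v * k) :: 'a)"
      by simp
    finally show False using uv one_notin_P by simp
  qed
next
  assume "int p dvd k"
  then obtain j where "k = int p * j" by blast
  then show "of_int k \<in> P"
    by (simp add: mult_P_right p_in_P of_int_R)
qed

lemma of_int_mult_in_P: "of_int k * x \<in> P \<Longrightarrow> x \<in> R \<Longrightarrow> \<not> int p dvd k \<Longrightarrow> x \<in> P"
  using prime_P[of "of_int k" x] of_int_in_P_iff of_int_R by blast

text \<open>The inner binomial coefficients are multiples of \<open>p\<close>, which lies in
  \<open>P\<close>.\<close>

lemma frobenius_add:
  assumes "x \<in> R" "y \<in> R"
  shows "(x + y) ^ p - (x ^ p + y ^ p) \<in> P"
proof -
  have p0: "p > 0" using prime_p by (simp add: prime_gt_0_nat)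
  have "(x + y) ^ p = (\<Sum>k\<le>p. of_nat (p choose k) * x ^ k * y ^ (p - k))"
    by (simp add: binomial_ring)
  also have "{..p} = insert 0 (insert p {1..<p})" using p0 by auto
  also have "(\<Sum>k\<in>\<dots>. of_nat (p choose k) * x ^ k * y ^ (p - k))
     = y ^ p + x ^ p + (\<Sum>k=1..<p. of_nat (p choose k) * x ^ k * y ^ (p - k))"
    using p0 by simp
  finally have "(x + y) ^ p - (x ^ p + y ^ p) = (\<Sum>k=1..<p. of_nat (p choose k) * x ^ k * y ^ (p - k))"
    by simp
  also have "\<dots> \<in> P"
  proof (rule sum_P)
    fix k assume "k \<in> {1..<p}"
    then have "p dvd (p choose k)"
      using prime_p by (intro dvd_choose_prime) auto
    then obtain j where "p choose k = p * j" by blast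
    then have "of_nat (p choose k) * x ^ k * y ^ (p - k) = of_nat p * (of_nat j * x ^ k * y ^ (p - k))"
      by (simp add: mult_ac)
    then show "of_nat (p choose k) * x ^ k * y ^ (p - k) \<in> P"
      using assms by (simp add: mult_P_right p_in_P closed_R)
  qed
  finally show ?thesis .
qed

text \<open>Fermat's little theorem drops out of \<open>frobenius_add\<close> at integers, where
  membership in \<open>P\<close> is divisibility by \<open>p\<close>.\<close>

lemma fermat_nat: "int p dvd int k ^ p - int k"
proof (induction k)
  case 0
  then show ?case using prime_gt_0_nat[OF prime_p] by (simp add: power_0_left)
next
  case (Suc k)
  have "(of_nat k + 1) ^ p - (of_nat k ^ p + 1 ^ p) \<in> P"
    by (intro frobenius_add of_nat_R one_R)
  then have "of_int ((int k + 1) ^ p - (int k ^ p + 1)) \<in> P" by simp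
  then have "int p dvd (int k + 1) ^ p - (int k ^ p + 1)" by (simp only: of_int_in_P_iff)
  from dvd_add[OF this Suc] show ?case by (simp add: algebra_simps)
qed

lemma fermat_int: "int p dvd k ^ p - k"
proof -
  define j where "j = nat (k mod int p)"
  have "[int j = k] (mod int p)"
    using prime_gt_0_nat[OF prime_p] by (simp add: j_def cong_def)
  then have "[k ^ p - k = int j ^ p - int j] (mod int p)"
    by (intro cong_diff cong_pow) (auto simp: cong_sym)
  then show ?thesis using fermat_nat[of j] by (simp add: cong_dvd_iff)
qed

text \<open>Modulo \<open>P\<close>, the \<open>p\<close>-th power replaces \<open>w\<close> by
  \<open>w ^ p\<close> and, by Fermat, leaves integer coefficients alone.\<close>

lemma frobenius_sum:
  assumes "w \<in> R"
  shows "(\<Sum>i<M. of_int (c i) * w ^ i) ^ p - (\<Sum>i<M. of_int (c i) * (w ^ p) ^ i) \<in> P"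
proof (induction M)
  case 0
  then show ?case using zero_P prime_gt_0_nat[OF prime_p] by (simp add: power_0_left)
next
  case (Suc M)
  let ?S = "\<Sum>i<M. of_int (c i) * w ^ i" and ?T = "\<Sum>i<M. of_int (c i) * (w ^ p) ^ i"
  have 1: "(?S + of_int (c M) * w ^ M) ^ p - (?S ^ p + (of_int (c M) * w ^ M) ^ p) \<in> P"
    using assms by (intro frobenius_add) (auto intro!: closed_R)
  have "of_int (c M ^ p - c M) * (w ^ M) ^ p \<in> P"
    by (intro mult_P_right closed_R assms) (use fermat_int of_int_in_P_iff in blast)
  then have 2: "(of_int (c M) * w ^ M) ^ p - of_int (c M) * (w ^ p) ^ M \<in> P"
    by (simp add: power_mult_distrib algebra_simps flip: power_mult)
  have "(?S + of_int (c M) * w ^ M) ^ p - (?T + of_int (c M) * (w ^ p) ^ M) =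
      ((?S + of_int (c M) * w ^ M) ^ p - (?S ^ p + (of_int (c M) * w ^ M) ^ p)) + (?S ^ p - ?T)
      + ((of_int (c M) * w ^ M) ^ p - of_int (c M) * (w ^ p) ^ M)"
    by simp
  also have "\<dots> \<in> P" using 1 2 Suc.IH by (intro add_P)
  finally show ?case by simp
qed

text \<open>Stability of \<open>P\<close> under the Frobenius automorphism, obtained without
  constructing the automorphism: if \<open>f(w)\<close> is in \<open>P\<close>, so is its
  \<open>p\<close>-th power, which is congruent to \<open>f(w ^ p)\<close>.\<close>

lemma frobenius_stable:
  assumes "w \<in> R" "(\<Sum>i<M. of_int (c i) * w ^ i) \<in> P"
  shows "(\<Sum>i<M. of_int (c i) * (w ^ p) ^ i) \<in> P"
proof -
  let ?S = "\<Sum>i<M. of_int (c i) * w ^ i" and ?T = "\<Sum>i<M. of_int (c i) * (w ^ p) ^ i"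
  have "?S ^ (p - 1) * ?S \<in> P"
    using assms by (intro mult_P) (auto intro!: closed_R)
  then have "?S ^ p \<in> P"
    using prime_gt_0_nat[OF prime_p] by (metis Suc_diff_1 power_Suc2)
  from diff_P[OF this frobenius_sum[OF assms(1), where c = c and M = M]]
 show ?thesis by simp
qed

lemma frobenius_power_stable:
  assumes "w \<in> R" "(\<Sum>i<M. of_int (c i) * w ^ i) \<in> P"
  shows "(\<Sum>i<M. of_int (c i) * (w ^ (p ^ k)) ^ i) \<in> P"
proof (induction k)
  case (Suc k)
  have "w ^ (p ^ k) \<in> R" using assms by (simp add: power_R)
  from frobenius_stable[OF this Suc] show ?case
    by (simp add: mult.commute flip: power_mult)
qed (use assms in simp)

text \<open>Some power of Frobenius maps \<open>w\<close> to \<open>-w\<close>, so that \<open>P\<close> contains the even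
  and the odd part of a polynomial in \<open>w\<close> separately; this is iterated.\<close>

lemma block_split:
  assumes q: "q = p ^ t" "q = 1 + 2 ^ e * l" "odd l" "e > 1" and p2: "odd p"
  shows "w \<in> R \<Longrightarrow> w ^ (2 ^ (s + e - 1)) = -1 \<Longrightarrow> (\<Sum>i<2 ^ s * M. of_int (c i) * w ^ i) \<in> P
    \<Longrightarrow> j < 2 ^ s \<Longrightarrow> (\<Sum>i<M. of_int (c (j + 2 ^ s * i)) * (w ^ (2 ^ s)) ^ i) \<in> P"
proof (induction s arbitrary: w c j)
  case 0
  then show ?case by simp
next
  case (Suc s)
  note w = Suc.prems(1)
  \<comment> \<open>Each squaring raises the exact power of 2 dividing
    \<open>q ^ (2 ^ s) - 1\<close> by one. Since \<open>e > 1\<close>, the correction term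
    \<open>2 ^ (s + e - 1) * l ^ 2\<close> is even and the cofactor stays odd.\<close>
  have "\<exists>l. odd l \<and> q ^ (2 ^ s) = 1 + 2 ^ (s + e) * l"
  proof (induction s)
    case 0
    then show ?case using q by auto
  next
    case (Suc s)
    then obtain l where l: "odd l" "q ^ (2 ^ s) = 1 + 2 ^ (s + e) * l" by blast
    have "q ^ (2 ^ Suc s) = (1 + 2 ^ (s + e) * l) ^ 2"
      using l by (metis power_Suc2 power_mult)
    also have "\<dots> = 1 + 2 ^ (Suc s + e) * (l + 2 ^ (s + e - 1) * l ^ 2)"
    proof -
      have "(2::nat) ^ (s + e) = 2 * 2 ^ (s + e - 1)"
        using \<open>e > 1\<close> by (cases e) simp_all
      then show ?thesis by (simp add: power2_eq_square algebra_simps)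
    qed
    finally have eq: "q ^ (2 ^ Suc s) = 1 + 2 ^ (Suc s + e) * (l + 2 ^ (s + e - 1) * l ^ 2)" .
    have "odd (l + 2 ^ (s + e - 1) * l ^ 2)" using l \<open>e > 1\<close> by simp
    with eq show ?case by blast
  qed
  then obtain l' where l': "odd l'" "q ^ (2 ^ s) = 1 + 2 ^ (s + e) * l'" by blast
  \<comment> \<open>Here \<open>w ^ (2 ^ (s + e))\<close> is -1 and \<open>l'\<close> is odd, so
    this power of Frobenius acts on \<open>w\<close> as a sign.\<close>
  have "w ^ (q ^ (2 ^ s)) = w * (w ^ (2 ^ (s + e))) ^ l'"
    using l' by (simp add: power_mult)
  also have "\<dots> = - w" using Suc.prems(2) l' by simp
  finally have wq: "w ^ (p ^ (t * 2 ^ s)) = - w"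
    using q by (simp add: power_mult)
  let ?f = "\<lambda>w :: 'a. \<Sum>i<2 ^ Suc s * M. of_int (c i) * w ^ i"
  let ?M = "2 ^ s * M"
  have minus: "?f (- w) \<in> P"
    using frobenius_power_stable[OF w Suc.prems(3), of "t * 2 ^ s"] wq by simp
  have split: "?f v = (\<Sum>i<?M. of_int (c (2 * i)) * (v\<^sup>2) ^ i) + v * (\<Sum>i<?M. of_int (c (2 * i + 1)) * (v\<^sup>2) ^ i)" for v
  proof -
    have "(\<Sum>i<2 * K. of_int (c i) * v ^ i) = (\<Sum>i<K. of_int (c (2 * i)) * (v\<^sup>2) ^ i)
        + v * (\<Sum>i<K. of_int (c (2 * i + 1)) * (v\<^sup>2) ^ i)" for K
    proof (induction K)
      case (Suc K)
      have "v ^ (2 * K) = (v\<^sup>2) ^ K" by (simp add: power_mult)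
      then show ?case by (simp add: Suc distrib_left mult.left_commute)
    qed simp
    from this[of ?M] show ?thesis by (simp add: mult.assoc)
  qed
  let ?E = "\<Sum>i<?M. of_int (c (2 * i)) * (w\<^sup>2) ^ i" and ?O = "\<Sum>i<?M. of_int (c (2 * i + 1)) * (w\<^sup>2) ^ i"
  have ER: "?E \<in> R" and OR: "?O \<in> R" using w by (auto intro!: closed_R)
  have n2: "\<not> int p dvd 2"
    using p2 prime_p by (metis dvd_refl even_of_nat int_dvd_int_iff of_nat_numeral prime_nat_iff' primes_dvd_imp_eq two_is_prime_nat)
  \<comment> \<open>Sum and difference isolate the even and the odd part; 2 cancels because
    \<open>p\<close> is odd, and \<open>w\<close> cancels because it is a unit.\<close>
  have "?f w + ?f (- w) \<in> P" "?f w - ?f (- w) \<in> P"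
    using Suc.prems(3) minus by (auto intro: add_P diff_P)
  then have "of_int 2 * ?E \<in> P" "of_int 2 * (w * ?O) \<in> P"
    unfolding split by (simp_all add: algebra_simps)
  then have E: "?E \<in> P" and wO: "w * ?O \<in> P"
    using of_int_mult_in_P[OF _ ER n2] of_int_mult_in_P[OF _ mult_R[OF w OR] n2] by blast+
  have "w * (- (w ^ (2 ^ (Suc s + e - 1) - 1))) = 1"
  proof -
    have "w * w ^ (2 ^ (Suc s + e - 1) - 1) = w ^ (2 ^ (Suc s + e - 1))"
      by (simp flip: power_Suc)
    then show ?thesis using Suc.prems(2) by simp
  qed
  from unit_notin_P[OF w _ this] have "w \<notin> P" using w by (simp add: closed_R)
  then have O: "?O \<in> P" using prime_P[OF w OR wO] by blast
  have w2: "w\<^sup>2 \<in> R" "(w\<^sup>2) ^ (2 ^ (s + e - 1)) = -1"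
  proof -
    have "2 * 2 ^ (s + e - 1) = (2::nat) ^ (Suc s + e - 1)"
      using \<open>e > 1\<close> by (cases e) simp_all
    then show "(w\<^sup>2) ^ (2 ^ (s + e - 1)) = -1" using Suc.prems(2) by (simp flip: power_mult)
  qed (use w in \<open>simp add: power_R\<close>)
  show ?case
  proof (cases "even j")
    case True
    then obtain k where k: "j = 2 * k" by blast
    then have "k < 2 ^ s" using Suc.prems(4) by simp
    from Suc.IH[OF w2 E this] show ?thesis
      by (simp add: k algebra_simps flip: power_mult)
  next
    case False
    then obtain k where k: "j = 2 * k + 1" by (auto elim: oddE)
    then have "k < 2 ^ s" using Suc.prems(4) by simp
    from Suc.IH[OF w2 O this] show ?thesis
      by (simp add: k algebra_simps flip: power_mult)
  qed
qed

end

section \<open>Residues modulo a prime ideal and blocks of coefficients\<close>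

abbreviation ipoly :: "int poly \<Rightarrow> 'a :: comm_ring_1 \<Rightarrow> 'a" where
  "ipoly f \<equiv> poly (map_poly of_int f)"

lemma ipoly_add: "ipoly (f + g) x = ipoly f x + ipoly g x"
proof -
  have "map_poly of_int (f + g) = (map_poly of_int f + map_poly of_int g :: 'a poly)"
    by (rule poly_eqI) (simp add: coeff_map_poly)
  then show ?thesis by simp
qed

lemma ipoly_smult: "ipoly (smult a f) x = of_int a * ipoly f x"
proof -
  have "map_poly of_int (smult a f) = (smult (of_int a) (map_poly of_int f) :: 'a poly)"
    by (rule poly_eqI) (simp add: coeff_map_poly)
  then show ?thesis by simp
qed

lemma ipoly_pCons: "ipoly (pCons a f) x = of_int a + x * ipoly f x"
  by (simp add: map_poly_pCons)

lemma ipoly_mult: "ipoly (f * g) x = ipoly f x * ipoly g x"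
  by (induction f)
     (simp_all add: map_poly_0 ipoly_pCons ipoly_add ipoly_smult algebra_simps del: map_poly_pCons)

lemma ipoly_monom: "ipoly (monom a k) x = of_int a * x ^ k"
  by (simp add: map_poly_monom poly_monom)

lemma ipoly_altdef: "degree f < N \<Longrightarrow> ipoly f x = (\<Sum>i<N. of_int (coeff f i) * x ^ i)"
proof -
  assume N: "degree f < N"
  have "ipoly f x = (\<Sum>i\<le>degree f. of_int (coeff f i) * x ^ i)"
  proof (induction f)
    case 0
    then show ?case by simp
  next
    case (pCons a f)
    then show ?case
      by (simp add: ipoly_pCons sum.atMost_Suc_shift sum_distrib_left mult_ac del: sum.atMost_Suc map_poly_pCons)
  qed
  also have "\<dots> = (\<Sum>i<N. of_int (coeff f i) * x ^ i)"
    using N by (intro sum.mono_neutral_left) (auto simp: coeff_eq_0)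
  finally show ?thesis .
qed

text \<open>Lagrange's theorem modulo \<open>p\<close>: split off the root \<open>m\<close> by
  synthetic division. The quotient still vanishes at the smaller points, because
  \<open>j - m\<close> is invertible modulo \<open>p\<close> for \<open>j < m < p\<close>.\<close>

lemma dvd_coeff_if_many_roots:
  fixes f :: "int poly"
  assumes "prime p" "m \<le> p"
  shows "degree f < m \<Longrightarrow> (\<And>j. j < m \<Longrightarrow> int p dvd poly f (int j)) \<Longrightarrow> int p dvd coeff f i"
  using assms(2)
proof (induction m arbitrary: f i)
  case (Suc m)
  let ?g = "synthetic_div f (int m)"
  have eq: "f = [:- int m, 1:] * ?g + [:poly f (int m):]"
    using synthetic_div_correct'[of "int m" f] by simp
  have g: "int p dvd coeff ?g i" for i
  proof (cases "m = 0")
    case True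
    then have "?g = 0" using Suc.prems by (simp add: synthetic_div_eq_0_iff)
    then show ?thesis by simp
  next
    case False
    show ?thesis
    proof (rule Suc.IH)
      show "degree ?g < m" using Suc.prems False by (auto simp: degree_synthetic_div)
      fix j assume j: "j < m"
      have "poly f (int j) = (int j - int m) * poly ?g (int j) + poly f (int m)"
        by (subst eq) (simp add: algebra_simps)
      then have "int p dvd (int j - int m) * poly ?g (int j)"
        using Suc.prems(2)[of j] Suc.prems(2)[of m] j by (metis dvd_add_left_iff less_Suc_eq)
      moreover have "\<not> int p dvd int j - int m"
        using j Suc.prems(3) zdvd_not_zless[of "int m - int j" "int p"] by (auto simp: dvd_diff_commute)
      ultimately show "int p dvd poly ?g (int j)"
        using assms(1) by (simp add: prime_dvd_mult_iff)
    qed (use Suc.prems in simp)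
  qed
  have "int p dvd poly f (int m)" using Suc.prems by simp
  then show ?case
    by (subst eq) (auto simp: coeff_pCons g split: nat.splits intro!: dvd_add dvd_diff dvd_mult)
qed simp

context prime_ideal_over
begin

text \<open>The residues fixed by Frobenius are those of the integers: \<open>X ^ p - X\<close>
  agrees modulo \<open>p\<close> with the product of the \<open>X - j\<close>, and since
  \<open>P\<close> is prime one factor \<open>z - j\<close> lies in it.\<close>

lemma int_residue:
  assumes z: "z \<in> R" and zp: "z ^ p - z \<in> P"
  shows "\<exists>j<p. z - of_nat j \<in> P"
proof -
  define g :: "int poly" where "g = (\<Prod>j<p. [:- int j, 1:])"
  \<comment> \<open>The difference of the two polynomials: its leading terms cancel, so it has
    degree below \<open>p\<close>, and it vanishes modulo \<open>p\<close> at
    \<open>0, ..., p - 1\<close>.\<close>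
  define f where "f = monom 1 p - g - monom 1 1"
  have p1: "p > 1" using prime_p prime_gt_1_nat by blast
  have g: "degree (\<Prod>j<k. [:- int j, 1:]) = k \<and> coeff (\<Prod>j<k. [:- int j, 1:]) k = 1" for k
  proof (induction k)
    case (Suc k)
    then have "(\<Prod>j<k. [:- int j, 1:]) \<noteq> 0" by auto
    then have "degree (\<Prod>j<Suc k. [:- int j, 1:]) = Suc k"
      using Suc by (simp add: degree_mult_eq del: mult_pCons_right)
    moreover from Suc have "lead_coeff (\<Prod>j<k. [:- int j, 1:]) = 1" by simp
    then have "lead_coeff (\<Prod>j<Suc k. [:- int j, 1:]) = 1"
      by (simp only: prod.lessThan_Suc lead_coeff_mult) simp
    ultimately show ?case by metis
  qed simp
  have "degree f < p"
  proof -
    have "degree f \<le> p"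
      unfolding f_def using g[of p] p1 by (intro degree_diff_le) (auto simp: g_def degree_monom_eq)
    moreover have "coeff f p = 0"
      using g[of p] p1 by (simp add: f_def g_def)
    ultimately show ?thesis using p1 by (metis coeff_0_degree_minus_1 degree_0 diff_less eq_zero_or_degree_less le_neq_implies_less less_trans zero_less_one leading_coeff_0_iff not_gr_zero)
  qed
  moreover have "int p dvd poly f (int j)" if "j < p" for j
  proof -
    have "poly g (int j) = 0" using that by (auto simp: g_def poly_prod)
    then have "poly f (int j) = int j ^ p - int j" by (simp add: f_def poly_monom)
    then show ?thesis using fermat_int by simp
  qed
  ultimately have dvd: "int p dvd coeff f i" for i
    using dvd_coeff_if_many_roots[of p p f] prime_p by simp
  have "ipoly f z = (\<Sum>i<Suc (degree f). of_int (coeff f i) * z ^ i)"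
    by (rule ipoly_altdef) simp
  also have "\<dots> \<in> P"
    using z dvd by (intro sum_P mult_P_right) (auto intro: power_R simp: of_int_in_P_iff)
  finally have fP: "ipoly f z \<in> P" .
  have "monom 1 p = f + g + monom 1 1" by (simp add: f_def)
  then have "ipoly (monom 1 p) z = ipoly f z + ipoly g z + ipoly (monom 1 1) z"
    by (simp only: ipoly_add)
  then have "ipoly g z = (z ^ p - z) - ipoly f z"
    by (simp add: ipoly_monom)
  also have "\<dots> \<in> P" using diff_P[OF zp fP] .
  finally have "ipoly g z \<in> P" .
  moreover have "ipoly (\<Prod>j<k. [:- int j, 1:]) z = (\<Prod>j<k. z - of_nat j)" for k
  proof (induction k)
    case (Suc k)
    then show ?case unfolding prod.lessThan_Suc by (simp add: ipoly_mult ipoly_pCons del: map_poly_pCons mult_pCons_right)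
  qed simp
  ultimately have "(\<Prod>j<p. z - of_nat j) \<in> P" by (simp add: g_def)
  then show ?thesis
    using prod_in_P[of "{..<p}" "\<lambda>j. z - of_nat j"] z by (auto intro: diff_R of_nat_R)
qed

end

text \<open>For \<open>w ^ 4 = -1\<close> and \<open>x\<close> the sum of the
  \<open>c i * w ^ i\<close>, the product of \<open>x\<close> with its complex conjugate is
  \<open>sq4 c + cross4 c * \<surd>2\<close>, where \<open>\<surd>2 = w - w ^ 3\<close>. The minus
  sign in \<open>cross4\<close> is the negacyclic wrap-around.\<close>

definition sq4 :: "(nat \<Rightarrow> int) \<Rightarrow> int" where
  "sq4 c = (c 0)\<^sup>2 + (c 1)\<^sup>2 + (c 2)\<^sup>2 + (c 3)\<^sup>2"

definition cross4 :: "(nat \<Rightarrow> int) \<Rightarrow> int" where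
  "cross4 c = c 0 * c 1 + c 1 * c 2 + c 2 * c 3 - c 3 * c 0"

lemma sq4_nonneg: "sq4 c \<ge> 0"
  by (simp add: sq4_def)

text \<open>\<open>cross4 c\<close> is the inner product of \<open>(c 0, c 2)\<close> and
  \<open>(c 1 - c 3, c 1 + c 3)\<close>, so Cauchy-Schwarz bounds its square by
  \<open>S * T\<close>; since \<open>2 * sq4 c = 2 * S + T\<close>, the inequality of the means
  finishes.\<close>

lemma cross4_bound: "2 * (cross4 c)\<^sup>2 \<le> (sq4 c)\<^sup>2"
proof -
  define S T where "S = (c 0)\<^sup>2 + (c 2)\<^sup>2" and "T = (c 1 - c 3)\<^sup>2 + (c 1 + c 3)\<^sup>2"
  have brahmagupta: "(x * y + z * u)\<^sup>2 + (x * u - z * y)\<^sup>2 = (x\<^sup>2 + z\<^sup>2) * (y\<^sup>2 + u\<^sup>2)" for x y z u :: int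
    by algebra
  have "cross4 c = c 0 * (c 1 - c 3) + c 2 * (c 1 + c 3)"
    by (simp add: cross4_def algebra_simps)
  then have "(cross4 c)\<^sup>2 + (c 0 * (c 1 + c 3) - c 2 * (c 1 - c 3))\<^sup>2 = S * T"
    unfolding S_def T_def using brahmagupta[of "c 0" "c 1 - c 3" "c 2" "c 1 + c 3"] by simp
  then have "(cross4 c)\<^sup>2 \<le> S * T"
    by (smt (verit) zero_le_power2)
  moreover have "2 * sq4 c = 2 * S + T"
    by (simp add: S_def T_def sq4_def power2_eq_square algebra_simps)
  then have "4 * (sq4 c)\<^sup>2 = (2 * S + T)\<^sup>2" by (simp add: power_mult_distrib flip: \<open>2 * sq4 c = 2 * S + T\<close>)
  moreover have "(2 * S + T)\<^sup>2 = (2 * S - T)\<^sup>2 + 8 * (S * T)"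
    by (simp add: power2_eq_square algebra_simps)
  ultimately show ?thesis using zero_le_power2[of "2 * S - T"] by linarith
qed

lemma sqrt2_cyclotomic8:
  fixes w :: "'a :: comm_ring_1"
  assumes "w ^ 4 = -1"
  shows "(w - w ^ 3)\<^sup>2 = 2"
proof -
  have "(w - w ^ 3)\<^sup>2 = w ^ 2 - 2 * w ^ 4 + w ^ 4 * w ^ 2"
    by (simp add: algebra_simps power_numeral_reduce)
  then show ?thesis using assms by simp
qed

text \<open>The second factor is the first with \<open>w\<close> replaced by its inverse
  \<open>- (w ^ 3)\<close>, that is, its complex conjugate.\<close>

lemma conj_product4:
  fixes w :: "'a :: comm_ring_1"
  assumes "w ^ 4 = -1"
  shows "(\<Sum>i<4. of_int (c i) * w ^ i) * (of_int (c 0) - of_int (c 1) * w ^ 3 - of_int (c 2) * w ^ 2 - of_int (c 3) * w)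
     = of_int (sq4 c) + of_int (cross4 c) * (w - w ^ 3)"
proof -
  have 1: "w * (w * (w * w)) = -1" using assms by (simp add: power_numeral_reduce)
  have 2: "w * (w * (w * (w * x))) = - x" for x using assms by (simp add: power_numeral_reduce flip: mult.assoc)
  show ?thesis
    by (simp add: eval_nat_numeral sq4_def cross4_def algebra_simps 1 2)
qed

context prime_ideal_over
begin

lemma block4_in_P:
  assumes "w \<in> R" "w ^ 4 = -1" "(\<Sum>i<4. of_int (c i) * w ^ i) \<in> P"
  shows "of_int (sq4 c) + of_int (cross4 c) * (w - w ^ 3) \<in> P"
  unfolding conj_product4[OF assms(2), symmetric]
  using assms by (intro mult_P_right) (auto intro!: closed_R)

text \<open>Frobenius sends \<open>w\<close> to \<open>w ^ 7\<close>, hence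
  \<open>v = w\<^sup>2\<close> to its inverse, so it conjugates the even part \<open>E\<close> and
  the odd part \<open>F\<close>. Both \<open>E + w F\<close> and \<open>E' + w ^ 7 F'\<close> lie in
  \<open>P\<close>, and eliminating the mixed term \<open>w F E'\<close> leaves the norm sum
  \<open>E E' + F F'\<close>.\<close>

lemma block8_in_P:
  assumes w: "w \<in> R" "w ^ 8 = -1" "(\<Sum>i<8. of_int (c i) * w ^ i) \<in> P" and p: "p mod 16 = 7"
  defines "e \<equiv> \<lambda>i. c (2 * i)" and "f \<equiv> \<lambda>i. c (1 + 2 * i)"
  shows "of_int (sq4 e + sq4 f) + of_int (cross4 e + cross4 f) * (w\<^sup>2 - (w\<^sup>2) ^ 3) \<in> P"
proof -
  define v where "v = w\<^sup>2"
  have v: "v ^ 4 = -1" using w(2) by (simp add: v_def flip: power_mult)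
  define E where "E = (\<Sum>i<4. of_int (e i) * v ^ i)"
  define F where "F = (\<Sum>i<4. of_int (f i) * v ^ i)"
  define E' where "E' = of_int (e 0) - of_int (e 1) * v ^ 3 - of_int (e 2) * v ^ 2 - of_int (e 3) * v"
  define F' where "F' = of_int (f 0) - of_int (f 1) * v ^ 3 - of_int (f 2) * v ^ 2 - of_int (f 3) * v"
  have "w ^ p = w ^ (16 * (p div 16) + 7)" using p by (metis mult_div_mod_eq)
  also have "\<dots> = (w ^ 8) ^ (2 * (p div 16)) * w ^ 7" by (simp add: power_add flip: power_mult)
  also have "\<dots> = w ^ 7" using w by simp
  finally have wp: "w ^ p = w ^ 7" .
  have y: "(\<Sum>i<8. of_int (c i) * w ^ i) = E + w * F"
    by (simp add: E_def F_def e_def f_def eval_nat_numeral v_def algebra_simps)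
  have R: "E \<in> R" "F \<in> R" "E' \<in> R" "F' \<in> R" "w * F \<in> R"
    unfolding E_def F_def E'_def F'_def v_def using w(1) by (auto intro!: closed_R)
  have yP: "E + w * F \<in> P" using w y by simp
  have "(\<Sum>i<8. of_int (c i) * (w ^ 7) ^ i) \<in> P"
    using frobenius_stable[OF w(1,3)] by (simp add: wp)
  also have "(\<Sum>i<8. of_int (c i) * (w ^ 7) ^ i) = E' + w ^ 7 * F'"
  proof -
    define u where "u = w ^ 7"
    have u: "u ^ k = w ^ (7 * k)" for k by (simp add: u_def power_mult)
    have w8: "w ^ (8 * j + k) = (-1) ^ j * w ^ k" for j k using w(2) by (simp add: power_add power_mult)
    have "v ^ 3 = - (u ^ 2)" "v ^ 2 = - (u ^ 4)" "v = - (u ^ 6)"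
      using w8[of 1 6] w8[of 3 4] w8[of 5 2] by (simp_all add: u v_def flip: power_mult)
    then have "E' = of_int (e 0) + of_int (e 1) * u ^ 2 + of_int (e 2) * u ^ 4 + of_int (e 3) * u ^ 6"
      "F' = of_int (f 0) + of_int (f 1) * u ^ 2 + of_int (f 2) * u ^ 4 + of_int (f 3) * u ^ 6"
      by (simp_all add: E'_def F'_def)
    then show ?thesis
      unfolding u_def[symmetric] by (simp add: e_def f_def eval_nat_numeral algebra_simps)
  qed
  finally have yP': "E' + w ^ 7 * F' \<in> P" .
  have "(E + w * F) * E' - (w * F) * (E' + w ^ 7 * F') \<in> P"
    using yP yP' R by (intro diff_P mult_P_right[OF yP] mult_P)
  also have "(E + w * F) * E' - (w * F) * (E' + w ^ 7 * F') = E * E' - w ^ 8 * (F * F')"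
    by (simp add: algebra_simps power_numeral_reduce)
  also have "\<dots> = E * E' + F * F'" using w by simp
  also have "E * E' = of_int (sq4 e) + of_int (cross4 e) * (v - v ^ 3)"
    unfolding E_def E'_def using v by (rule conj_product4)
  also have "F * F' = of_int (sq4 f) + of_int (cross4 f) * (v - v ^ 3)"
    unfolding F_def F'_def using v by (rule conj_product4)
  finally show ?thesis by (simp add: v_def algebra_simps)
qed

end

section \<open>The equation \<open>a\<^sup>2 - 2 b\<^sup>2 = p\<close>\<close>

text \<open>The multiplicity of \<open>q\<close> would be even on the left and odd on the
  right.\<close>

lemma square_eq_prime_times_square:
  fixes a b q :: int
  assumes "prime q" "a\<^sup>2 = q * b\<^sup>2"
  shows "a = 0"
proof (rule ccontr)
  assume a: "a \<noteq> 0"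
  then have b: "b \<noteq> 0" using assms(2) by auto
  have q: "prime_elem q" using assms(1) by (rule prime_imp_prime_elem)
  have q': "q \<noteq> 0" "\<not> q dvd 1" using prime_elem_not_unit[OF q] prime_elem_not_zeroI[OF q] by blast+
  have "multiplicity q (a\<^sup>2) = 2 * multiplicity q a"
    using a q by (simp add: prime_elem_multiplicity_power_distrib)
  moreover have "multiplicity q (q * b\<^sup>2) = Suc (2 * multiplicity q b)"
    using b q q' by (simp add: multiplicity_times_same prime_elem_multiplicity_power_distrib)
  ultimately have "2 * multiplicity q a = Suc (2 * multiplicity q b)" using assms(2) by simp
  then show False by presburger
qed

text \<open>The product of \<open>a d - c b\<close> and \<open>a d + c b\<close> is
  \<open>p * (d\<^sup>2 - b\<^sup>2)\<close>, so \<open>p\<close> divides one of them. The size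
  bounds then force that factor to vanish, whence \<open>b\<^sup>2 = d\<^sup>2\<close>.\<close>

lemma pell_minimal_unique:
  fixes a b c d p :: int
  assumes p: "prime p" "odd p" and pos: "a > 0" "b \<ge> 0" "c > 0" "d \<ge> 0"
    and ab: "a\<^sup>2 - 2 * b\<^sup>2 = p" and cd: "c\<^sup>2 - 2 * d\<^sup>2 = p"
    and le: "a\<^sup>2 \<le> 2 * p" "c\<^sup>2 \<le> 2 * p"
  shows "a = c"
proof -
  have p0: "p > 0" using p prime_gt_0_int by blast
  \<comment> \<open>Equality would make \<open>p\<close> even.\<close>
  have strict: "x\<^sup>2 < 2 * p" if "x\<^sup>2 \<le> 2 * p" for x
  proof -
    have "x\<^sup>2 \<noteq> 2 * p"
    proof
      assume x: "x\<^sup>2 = 2 * p"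
      then have "even x" by (metis dvd_triv_left even_power)
      then obtain y where "x = 2 * y" by blast
      with x have "2 * y\<^sup>2 = p" by (simp add: power_mult_distrib)
      then show False using p(2) by auto
    qed
    with that show ?thesis by simp
  qed
  \<comment> \<open>As \<open>2 * d\<^sup>2 = c\<^sup>2 - p\<close> is at most \<open>p\<close>, and
    likewise for \<open>b\<close>, both \<open>a d\<close> and \<open>c b\<close> are at most
    \<open>p\<close>; strictness in one of them keeps their sum below \<open>2 * p\<close>.\<close>
  have "2 * (a * d)\<^sup>2 = a\<^sup>2 * (2 * d\<^sup>2)" by (simp add: power_mult_distrib)
  also have "\<dots> \<le> 2 * p * p" using le cd p0 by (intro mult_mono) auto
  finally have 1: "(a * d)\<^sup>2 \<le> p\<^sup>2" by (simp add: power2_eq_square)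
  have "2 * (c * b)\<^sup>2 = c\<^sup>2 * (2 * b\<^sup>2)" by (simp add: power_mult_distrib)
  also have "\<dots> < 2 * p * p" using strict[OF le(2)] strict[OF le(1)] ab p0
    by (intro mult_strict_mono') auto
  finally have 2: "(c * b)\<^sup>2 < p\<^sup>2" by (simp add: power2_eq_square)
  have bound: "a * d \<le> p" "c * b < p"
    using power2_le_imp_le[OF 1] power_less_imp_less_base[OF 2] p0 by simp_all
  \<comment> \<open>The only nonzero candidates are \<open>X = p\<close> and \<open>X = - p\<close>;
    they would give \<open>Y\<^sup>2 = 3 * p\<^sup>2\<close>.\<close>
  have zero: "X = 0" if X: "p dvd X" "\<bar>X\<bar> < 2 * p" "Y\<^sup>2 - 2 * X\<^sup>2 = p\<^sup>2" for X Y
  proof (rule ccontr)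
    assume "X \<noteq> 0"
    obtain k where k: "X = p * k" using X by blast
    have "\<bar>k\<bar> < 2" using X(2) k p0 by (simp add: abs_mult)
    with \<open>X \<noteq> 0\<close> k have "k = 1 \<or> k = -1" by auto
    then have "X\<^sup>2 = p\<^sup>2" using k by auto
    then have "Y\<^sup>2 = 3 * p\<^sup>2" using X by simp
    then have "Y = 0" by (rule square_eq_prime_times_square[rotated]) simp
    then show False using \<open>Y\<^sup>2 = 3 * p\<^sup>2\<close> p0 by simp
  qed
  \<comment> \<open>Multiplicativity of the norm for \<open>a + b \<surd>2\<close> times
    \<open>c - d \<surd>2\<close>, respectively \<open>c + d \<surd>2\<close>.\<close>
  have "(a * c - 2 * b * d)\<^sup>2 - 2 * (a * d - c * b)\<^sup>2 = (a\<^sup>2 - 2 * b\<^sup>2) * (c\<^sup>2 - 2 * d\<^sup>2)"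
    "(a * c + 2 * b * d)\<^sup>2 - 2 * (a * d + c * b)\<^sup>2 = (a\<^sup>2 - 2 * b\<^sup>2) * (c\<^sup>2 - 2 * d\<^sup>2)"
    by (simp_all add: power2_eq_square algebra_simps)
  then have norm: "(a * c - 2 * b * d)\<^sup>2 - 2 * (a * d - c * b)\<^sup>2 = p\<^sup>2"
    "(a * c + 2 * b * d)\<^sup>2 - 2 * (a * d + c * b)\<^sup>2 = p\<^sup>2"
    unfolding ab cd by (simp_all only: power2_eq_square)
  have "a\<^sup>2 = p + 2 * b\<^sup>2" "c\<^sup>2 = p + 2 * d\<^sup>2" using ab cd by auto
  moreover have "(a * d - c * b) * (a * d + c * b) = a\<^sup>2 * d\<^sup>2 - c\<^sup>2 * b\<^sup>2"
    by (simp add: power2_eq_square algebra_simps)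
  ultimately have prod: "(a * d - c * b) * (a * d + c * b) = p * (d\<^sup>2 - b\<^sup>2)"
    by (simp add: algebra_simps)
  then have "p dvd (a * d - c * b) \<or> p dvd (a * d + c * b)"
    using p(1) by (metis dvd_triv_left prime_dvd_mult_iff)
  moreover have "a * d \<ge> 0" "c * b \<ge> 0" using pos by simp_all
  then have "\<bar>a * d - c * b\<bar> < 2 * p" "\<bar>a * d + c * b\<bar> < 2 * p" using bound p0 by linarith+
  ultimately have "a * d - c * b = 0 \<or> a * d + c * b = 0"
    using zero norm by blast
  then have "(a * d - c * b) * (a * d + c * b) = 0" by (simp only: mult_eq_0_iff)
  then have "p * (d\<^sup>2 - b\<^sup>2) = 0" unfolding prod .
  then have "d\<^sup>2 - b\<^sup>2 = 0" using p0 by (simp add: mult_eq_0_iff)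
  then have "a\<^sup>2 = c\<^sup>2" using ab cd by linarith
  then show ?thesis using pos by (simp add: power2_eq_iff_nonneg)
qed

lemma a_p_minimal:
  fixes p a b :: int
  assumes p: "prime p" and ab: "a > 0" "a\<^sup>2 - 2 * b\<^sup>2 = p"
  shows "a_p p \<le> a" and "a_p p > 0" and "\<exists>b>0. (a_p p)\<^sup>2 - 2 * b\<^sup>2 = p"
proof -
  define Q where "Q a \<longleftrightarrow> a > 0 \<and> (\<exists>b::int. b > 0 \<and> a\<^sup>2 - 2 * b\<^sup>2 = p)" for a
  have "b \<noteq> 0"
  proof
    assume "b = 0"
    then have "a\<^sup>2 = p * 1\<^sup>2" using ab(2) by simp
    then have "a = 0" by (rule square_eq_prime_times_square[OF p])
    then show False using ab(1) by simp
  qed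
  then have "0 < \<bar>b\<bar> \<and> a\<^sup>2 - 2 * \<bar>b\<bar>\<^sup>2 = p" using ab(2) by (simp (no_asm_simp))
  then have Qa: "Q a" using ab(1) unfolding Q_def by blast
  \<comment> \<open>\<open>LEAST\<close> over the integers needs an exhibited minimum; as all
    solutions are positive, it is found through \<open>nat\<close>.\<close>
  then obtain x where x: "Q x" "\<And>y. Q y \<Longrightarrow> nat x \<le> nat y"
    using ex_has_least_nat[of Q a nat] by blast
  have le: "x \<le> y" if "Q y" for y
    using x(2)[OF that] that by (simp add: nat_le_eq_zle Q_def)
  have eq: "a_p p = x"
    unfolding a_p_def Q_def[symmetric] by (rule Least_equality, rule x(1), erule le)
  show "a_p p \<le> a" "a_p p > 0" "\<exists>b>0. (a_p p)\<^sup>2 - 2 * b\<^sup>2 = p"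
    unfolding eq using le[OF Qa] x(1) unfolding Q_def by blast+
qed

text \<open>Multiplication of \<open>x + y \<surd>2\<close> by \<open>(1 \<plusminus> \<surd>2)\<^sup>2 = 3 \<plusminus> 2 \<surd>2\<close> lowers \<open>x\<close> unless \<open>x\<^sup>2 \<le> 2 p\<close>.\<close>

lemma pell_descent:
  fixes S :: "(int \<times> int) set" and p :: int
  assumes pos: "\<And>x y. (x, y) \<in> S \<Longrightarrow> x > 0 \<and> x\<^sup>2 - 2 * y\<^sup>2 = p"
    and plus: "\<And>x y. (x, y) \<in> S \<Longrightarrow> (3 * x + 4 * y, 3 * y + 2 * x) \<in> S"
    and minus: "\<And>x y. (x, y) \<in> S \<Longrightarrow> (3 * x - 4 * y, 3 * y - 2 * x) \<in> S"
    and xy: "(x, y) \<in> S" "\<And>x' y'. (x', y') \<in> S \<Longrightarrow> x \<le> x'"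
  shows "x\<^sup>2 \<le> 2 * p"
proof -
  have "x \<le> 3 * x + 4 * y" "x \<le> 3 * x - 4 * y"
    using xy(2)[OF plus[OF xy(1)]] xy(2)[OF minus[OF xy(1)]] by simp_all
  then have "\<bar>2 * y\<bar> \<le> \<bar>x\<bar>" using pos[OF xy(1)] by linarith
  then have "(2 * y)\<^sup>2 \<le> x\<^sup>2" by (rule abs_le_square_iff[THEN iffD1])
  then show ?thesis using pos[OF xy(1)] by (simp add: power_mult_distrib)
qed

text \<open>From \<open>a\<^sup>2 > 2 * b\<^sup>2\<close> follows
  \<open>9 * a\<^sup>2 > 16 * b\<^sup>2\<close>. Thus multiplication by
  \<open>3 \<plusminus> 2 \<surd>2\<close> keeps the first coordinate positive.\<close>

lemma pell_step_pos:
  fixes a b p :: int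
  assumes "a > 0" "a\<^sup>2 - 2 * b\<^sup>2 = p" "p > 0"
  shows "3 * a + 4 * b > 0" "3 * a - 4 * b > 0"
proof -
  have "16 * b\<^sup>2 < 9 * a\<^sup>2"
    using assms zero_le_power2[of b] by linarith
  then have "(4 * b)\<^sup>2 < (3 * a)\<^sup>2" by (simp add: power_mult_distrib)
  then have "\<bar>4 * b\<bar> < \<bar>3 * a\<bar>" using abs_le_square_iff[of "3 * a" "4 * b"] by linarith
  then show "3 * a + 4 * b > 0" "3 * a - 4 * b > 0" using assms by auto
qed

text \<open>\<open>pell_descent\<close> applied to the set of all solutions with positive first
  coordinate.\<close>

lemma a_p_square_le:
  fixes p a b :: int
  assumes p: "prime p" and ab: "a > 0" "a\<^sup>2 - 2 * b\<^sup>2 = p"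
  shows "(a_p p)\<^sup>2 \<le> 2 * p"
proof -
  define S where "S = {(x, y). x > 0 \<and> x\<^sup>2 - 2 * y\<^sup>2 = p}"
  have p0: "p > 0" using p prime_gt_0_int by blast
  obtain d where "(a_p p, d) \<in> S" using a_p_minimal[OF p ab] by (auto simp: S_def)
  then show ?thesis
  proof (rule pell_descent[rotated 3])
    show "(3 * x + 4 * y, 3 * y + 2 * x) \<in> S" "(3 * x - 4 * y, 3 * y - 2 * x) \<in> S" if "(x, y) \<in> S" for x y
    proof -
      have "(3 * x + 4 * y)\<^sup>2 - 2 * (3 * y + 2 * x)\<^sup>2 = x\<^sup>2 - 2 * y\<^sup>2"
        "(3 * x - 4 * y)\<^sup>2 - 2 * (3 * y - 2 * x)\<^sup>2 = x\<^sup>2 - 2 * y\<^sup>2"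
        by (simp_all add: power2_eq_square algebra_simps)
      then show "(3 * x + 4 * y, 3 * y + 2 * x) \<in> S" "(3 * x - 4 * y, 3 * y - 2 * x) \<in> S"
        using that pell_step_pos[of x y p] p0 by (auto simp: S_def)
    qed
  qed (use a_p_minimal[OF p] in \<open>auto simp: S_def\<close>)
qed

text \<open>\<open>S\<close> will hold the solutions coming from elements of \<open>P\<close>. Its
  member with least \<open>x\<close> has \<open>x\<^sup>2 \<le> 2 * p\<close> by descent, and so has
  the global minimum \<open>a_p p\<close>; uniqueness in that range identifies the two.\<close>

lemma a_p_attained:
  fixes S :: "(int \<times> int) set" and p :: int
  assumes p: "prime p" "odd p"
    and pos: "\<And>x y. (x, y) \<in> S \<Longrightarrow> x > 0 \<and> x\<^sup>2 - 2 * y\<^sup>2 = p"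
    and plus: "\<And>x y. (x, y) \<in> S \<Longrightarrow> (3 * x + 4 * y, 3 * y + 2 * x) \<in> S"
    and minus: "\<And>x y. (x, y) \<in> S \<Longrightarrow> (3 * x - 4 * y, 3 * y - 2 * x) \<in> S"
    and ne: "S \<noteq> {}"
  shows "\<exists>y. (a_p p, y) \<in> S"
proof -
  obtain z0 where "z0 \<in> S" using ne by blast
  then obtain z where z: "z \<in> S" "\<And>z'. z' \<in> S \<Longrightarrow> nat (fst z) \<le> nat (fst z')"
    using ex_has_least_nat[of "\<lambda>z. z \<in> S" z0 "\<lambda>z. nat (fst z)"] by blast
  obtain x y where xy_def: "z = (x, y)" by (cases z)
  have xy: "(x, y) \<in> S" "\<And>x' y'. (x', y') \<in> S \<Longrightarrow> nat x \<le> nat x'"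
    using z(1) z(2)[of "(x', y')" for x' y'] by (simp_all add: xy_def)
  have min: "x \<le> x'" if "(x', y') \<in> S" for x' y'
    using xy(2)[OF that] pos[OF that] by (simp add: nat_le_eq_zle)
  have x: "x\<^sup>2 \<le> 2 * p"
    by (rule pell_descent[OF pos plus minus xy(1) min])
  have xp: "x > 0" "x\<^sup>2 - 2 * y\<^sup>2 = p" using pos[OF xy(1)] by auto
  obtain d where d: "d > 0" "(a_p p)\<^sup>2 - 2 * d\<^sup>2 = p" using a_p_minimal[OF p(1) xp] by blast
  have "a_p p = x"
    by (rule pell_minimal_unique[OF p, of _ d _ "\<bar>y\<bar>"])
       (use d xp x a_p_minimal(2)[OF p(1) xp] a_p_square_le[OF p(1) xp] in auto)
  then show ?thesis using xy by blast
qed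

text \<open>The norm is a positive multiple \<open>p * k\<close>. For \<open>k = 1\<close> the
  minimality of \<open>a_p p\<close> applies; for \<open>k \<ge> 2\<close> already
  \<open>A\<^sup>2 \<ge> 2 * p\<close>, which is at least the square of
  \<open>a_p p\<close>.\<close>

lemma a_p_le_if_dvd:
  fixes p A B a b :: int
  assumes p: "prime p" and ab: "a > 0" "a\<^sup>2 - 2 * b\<^sup>2 = p"
    and A: "A > 0" "2 * B\<^sup>2 \<le> A\<^sup>2" "p dvd A\<^sup>2 - 2 * B\<^sup>2"
  shows "a_p p \<le> A"
proof -
  have p0: "p > 0" using p prime_gt_0_int by blast
  obtain k where k: "A\<^sup>2 - 2 * B\<^sup>2 = p * k" using A by blast
  have "A\<^sup>2 \<noteq> 2 * B\<^sup>2" using square_eq_prime_times_square[of 2 A B] A(1) by force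
  then have "p * k > 0" using A k by linarith
  then have "k > 0" using p0 by (simp add: zero_less_mult_iff)
  show ?thesis
  proof (cases "k = 1")
    case True
    then have "A\<^sup>2 - 2 * B\<^sup>2 = p" using k by simp
    then show ?thesis by (rule a_p_minimal(1)[OF p A(1)])
  next
    case False
    then have "p * 2 \<le> p * k" using \<open>k > 0\<close> p0 by (intro mult_left_mono) auto
    then have "(a_p p)\<^sup>2 \<le> A\<^sup>2"
      using a_p_square_le[OF p ab] k zero_le_power2[of B] by linarith
    then show ?thesis by (rule power2_le_imp_le) (simp add: less_imp_le[OF A(1)])
  qed
qed

section \<open>Minkowski's theorem for ellipsoids\<close>

text \<open>If no point of the unit cube were covered by more than \<open>m\<close> integer
  translates of \<open>S\<close>, integrating the number of coverings over the cube would bound the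
  volume of \<open>S\<close> by \<open>m\<close>.\<close>

lemma blichfeldt:
  fixes S :: "(real ^ 'n) set"
  assumes S: "S \<in> lmeasurable" "bounded S" and m: "measure lebesgue S > real m"
  shows "\<exists>x Z :: ('n \<Rightarrow> int) set. finite Z \<and> card Z > m \<and> (\<forall>z\<in>Z. x + (\<chi> i. of_int (z i)) \<in> S)"
proof (rule ccontr)
  assume contra: "\<not> ?thesis"
  define v :: "('n \<Rightarrow> int) \<Rightarrow> real ^ 'n" where "v z = (\<chi> i. of_int (z i))" for z
  define C :: "(real ^ 'n) set" where "C = cbox 0 1"
  obtain K :: real where K: "\<And>y. y \<in> S \<Longrightarrow> norm y \<le> K"
    using S(2) by (auto simp: bounded_iff)
  \<comment> \<open>Boundedness of \<open>S\<close> lets finitely many translation vectors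
    suffice.\<close>
  define Z :: "('n \<Rightarrow> int) set" where "Z = PiE UNIV (\<lambda>_. {\<lfloor>- K\<rfloor>..\<lfloor>K\<rfloor>})"
  have finZ: "finite Z" unfolding Z_def by (intro finite_PiE) auto
  define T where "T z = C \<inter> (\<lambda>x. - v z + x) ` S" for z
  have T: "T z \<in> lmeasurable" for z
    unfolding T_def C_def using S by (intro fmeasurable.Int lmeasurable_cbox measurable_translation)
  have int: "integrable lebesgue (indicat_real (T z))" for z
    using T[of z] unfolding fmeasurable_def mem_Collect_eq by (intro integrable_real_indicator) auto
  have cover: "S \<subseteq> (\<Union>z\<in>Z. (\<lambda>x. v z + x) ` T z)"
  proof
    fix y assume y: "y \<in> S"
    \<comment> \<open>The componentwise floor moves \<open>y\<close> into the unit cube.\<close>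
    define z where "z = (\<lambda>i. \<lfloor>y $ i\<rfloor>)"
    have "z \<in> Z"
      unfolding Z_def
    proof (rule PiE_I)
      fix i :: 'n
      have "\<bar>y $ i\<bar> \<le> K" using K[OF y] component_le_norm_cart[of y i] by linarith
      then show "z i \<in> {\<lfloor>- K\<rfloor>..\<lfloor>K\<rfloor>}" unfolding z_def by (auto intro!: floor_mono)
    qed simp
    moreover have "- v z + y \<in> C"
      by (auto simp: C_def mem_box_cart v_def z_def) linarith+
    then have "- v z + y \<in> T z" using y by (auto simp: T_def)
    then have "y \<in> (\<lambda>x. v z + x) ` T z" by (auto intro: image_eqI[of _ _ "- v z + y"])
    ultimately show "y \<in> (\<Union>z\<in>Z. (\<lambda>x. v z + x) ` T z)" by blast
  qed
  have "measure lebesgue S \<le> measure lebesgue (\<Union>z\<in>Z. (\<lambda>x. v z + x) ` T z)"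
    using cover S T finZ
    by (intro measure_mono_fmeasurable fmeasurable.finite_UN measurable_translation) (auto simp: fmeasurableD)
  also have "\<dots> \<le> (\<Sum>z\<in>Z. measure lebesgue ((\<lambda>x. v z + x) ` T z))"
    using T finZ by (intro measure_UNION_le) (auto intro: fmeasurableD measurable_translation)
  also have "\<dots> = (\<Sum>z\<in>Z. measure lebesgue (T z))"
    by (simp add: measure_translation)
  also have "\<dots> = (\<Sum>z\<in>Z. integral\<^sup>L lebesgue (indicat_real (T z)))"
    by simp
  also have "\<dots> = integral\<^sup>L lebesgue (\<lambda>x. \<Sum>z\<in>Z. indicat_real (T z) x)"
    using int by (intro Bochner_Integration.integral_sum[symmetric])
  also have "\<dots> \<le> integral\<^sup>L lebesgue (\<lambda>x. real m * indicat_real C x)"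
  proof (rule integral_mono)
    show "integrable lebesgue (\<lambda>x. \<Sum>z\<in>Z. indicat_real (T z) x)"
      using int by (intro Bochner_Integration.integrable_sum)
    show "integrable lebesgue (\<lambda>x. real m * indicat_real C x)"
      unfolding C_def by (intro integrable_mult_right integrable_real_indicator) (auto simp: emeasure_lborel_cbox_eq)
    fix x
    have "(\<Sum>z\<in>Z. indicat_real (T z) x) \<le> indicat_real C x * card {z \<in> Z. x + v z \<in> S}"
    proof -
      have "(\<Sum>z\<in>Z. indicat_real (T z) x) \<le> (\<Sum>z\<in>Z. indicat_real C x * (if x + v z \<in> S then 1 else 0))"
        by (intro sum_mono) (auto simp: T_def indicator_def algebra_simps)
      also have "\<dots> = indicat_real C x * card {z \<in> Z. x + v z \<in> S}"
        using finZ by (simp flip: sum_distrib_left sum.inter_filter)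
      finally show ?thesis .
    qed
    also have "card {z \<in> Z. x + v z \<in> S} \<le> m"
    proof (rule ccontr)
      assume "\<not> card {z \<in> Z. x + v z \<in> S} \<le> m"
      then have "finite {z \<in> Z. x + v z \<in> S} \<and> m < card {z \<in> Z. x + v z \<in> S} \<and>
          (\<forall>z\<in>{z \<in> Z. x + v z \<in> S}. x + (\<chi> i. of_int (z i)) \<in> S)"
        using finZ by (auto simp: v_def)
      then show False using contra by blast
    qed
    then have "indicat_real C x * card {z \<in> Z. x + v z \<in> S} \<le> real m * indicat_real C x"
      by (auto simp: indicator_def)
    finally show "(\<Sum>z\<in>Z. indicat_real (T z) x) \<le> real m * indicat_real C x" .
  qed
  also have "\<dots> = real m"
    by (simp add: C_def content_cbox_if_cart interval_eq_empty_cart)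
  finally show False using m by simp
qed

text \<open>The ellipsoid is the image of the ball of radius \<open>r\<close> under the diagonal
  scaling by \<open>1 / sqrt (w k)\<close>.\<close>

lemma measure_ellipsoid:
  fixes w :: "'n :: finite \<Rightarrow> real"
  assumes w: "\<And>i. w i > 0" and r: "r > 0"
  defines "S \<equiv> {y :: real ^ 'n. (\<Sum>i\<in>UNIV. w i * (y $ i)\<^sup>2) < r\<^sup>2}"
  shows "S \<in> lmeasurable" "bounded S"
    "measure lebesgue S * (\<Prod>i\<in>UNIV. sqrt (w i)) = unit_ball_vol (real CARD('n)) * r ^ CARD('n)"
proof -
  define f :: "real ^ 'n \<Rightarrow> real ^ 'n" where "f x = (\<chi> k. (1 / sqrt (w k)) * x $ k)" for x
  have w0: "sqrt (w i) > 0" for i using w by simp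
  have S: "S = f ` ball 0 r"
  proof (intro equalityI subsetI)
    fix y assume y: "y \<in> S"
    define x :: "real ^ 'n" where "x = (\<chi> k. sqrt (w k) * y $ k)"
    have "norm x = sqrt (\<Sum>i\<in>UNIV. w i * (y $ i)\<^sup>2)"
      unfolding norm_vec_def L2_set_def using w by (simp add: x_def abs_mult power_mult_distrib less_imp_le)
    also have "\<dots> < r" using y r by (intro real_less_lsqrt) (auto simp: S_def)
    finally have "x \<in> ball 0 r" by simp
    moreover have "y = f x" using w0 by (simp add: vec_eq_iff f_def x_def less_imp_neq[symmetric])
    ultimately show "y \<in> f ` ball 0 r" by blast
  next
    fix y assume "y \<in> f ` ball 0 r"
    then obtain x where x: "norm x < r" "y = f x" by auto
    have "(norm x)\<^sup>2 < r\<^sup>2" using x by (intro power_strict_mono) auto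
    moreover have "(norm x)\<^sup>2 = (\<Sum>i\<in>UNIV. (x $ i)\<^sup>2)"
      unfolding norm_vec_def L2_set_def by (simp add: sum_nonneg)
    moreover have "w i * (y $ i)\<^sup>2 = (x $ i)\<^sup>2" for i
      using w[of i] by (simp add: x f_def power_mult_distrib power_divide less_imp_le)
    ultimately show "y \<in> S" by (simp add: S_def)
  qed
  show "S \<in> lmeasurable" unfolding S f_def by (intro measurable_stretch) simp_all
  have "linear f" by (auto intro!: linearI simp: f_def vec_eq_iff algebra_simps)
  then show "bounded S" unfolding S by (intro bounded_linear_image) (simp_all add: linear_conv_bounded_linear)
  have "measure lebesgue S = \<bar>\<Prod>k\<in>UNIV. 1 / sqrt (w k)\<bar> * measure lebesgue (ball (0 :: real ^ 'n) r)"
    unfolding S f_def by (intro measure_stretch) simp_all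
  also have "measure lebesgue (ball (0 :: real ^ 'n) r) = unit_ball_vol (real CARD('n)) * r ^ CARD('n)"
    using content_ball[of r "0 :: real ^ 'n"] r by simp
  also have "\<bar>\<Prod>k\<in>UNIV. 1 / sqrt (w k)\<bar> = 1 / (\<Prod>i\<in>UNIV. sqrt (w i))"
    using w0 by (simp add: prod_dividef abs_prod less_imp_le)
  finally show "measure lebesgue S * (\<Prod>i\<in>UNIV. sqrt (w i)) = unit_ball_vol (real CARD('n)) * r ^ CARD('n)"
    using w0 by (simp add: less_imp_neq[symmetric])
qed

text \<open>Minkowski's theorem with a pigeonhole in place of a lattice covolume: more than
  \<open>card A\<close> integer points lie in one translate of the ellipsoid, so two share a class.
  Their difference is estimated by
  \<open>(x - y)\<^sup>2 \<le> 2 * x\<^sup>2 + 2 * y\<^sup>2\<close>, whence the factor 4.\<close>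

lemma minkowski_residue_classes:
  fixes w :: "'n :: finite \<Rightarrow> real" and cls :: "('n \<Rightarrow> int) \<Rightarrow> 'b"
  assumes w: "\<And>i. w i > 0" and r: "r > 0" and cls: "\<And>z. cls z \<in> A" "finite A"
    and vol: "unit_ball_vol (real CARD('n)) * r ^ CARD('n) > real (card A) * (\<Prod>i\<in>UNIV. sqrt (w i))"
  shows "\<exists>z z'. z \<noteq> z' \<and> cls z = cls z' \<and> (\<Sum>i\<in>UNIV. w i * (of_int (z i - z' i))\<^sup>2) < 4 * r\<^sup>2"
proof -
  define S where "S = {y :: real ^ 'n. (\<Sum>i\<in>UNIV. w i * (y $ i)\<^sup>2) < r\<^sup>2}"
  note S = measure_ellipsoid[of w, OF w r, folded S_def]
  have "(\<Prod>i\<in>UNIV. sqrt (w i)) > 0" using w by (simp add: prod_pos)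
  then have "measure lebesgue S > real (card A)"
    using vol S(3) by (metis mult_less_cancel_right_pos)
  from blichfeldt[OF S(1,2) this] obtain x and Z :: "('n \<Rightarrow> int) set"
    where Z: "finite Z" "card Z > card A" "\<And>z. z \<in> Z \<Longrightarrow> x + (\<chi> i. of_int (z i)) \<in> S"
    by auto
  have "card (cls ` Z) \<le> card A" using cls by (intro card_mono) auto
  then have "\<not> inj_on cls Z" using Z by (metis card_image not_less)
  then obtain z z' where z: "z \<in> Z" "z' \<in> Z" "z \<noteq> z'" "cls z = cls z'" by (auto simp: inj_on_def)
  have "(\<Sum>i\<in>UNIV. w i * (of_int (z i - z' i))\<^sup>2) \<le>
      (\<Sum>i\<in>UNIV. 2 * (w i * (x $ i + of_int (z i))\<^sup>2) + 2 * (w i * (x $ i + of_int (z' i))\<^sup>2))"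
  proof (rule sum_mono)
    fix i
    have "(of_int (z i - z' i))\<^sup>2 \<le> 2 * (x $ i + of_int (z i))\<^sup>2 + 2 * (x $ i + of_int (z' i))\<^sup>2"
      using zero_le_power2[of "(x $ i + of_int (z i)) + (x $ i + of_int (z' i))"]
      by (simp add: power2_eq_square algebra_simps)
    from mult_left_mono[OF this less_imp_le[OF w[of i]]]
    show "w i * (of_int (z i - z' i))\<^sup>2 \<le> 2 * (w i * (x $ i + of_int (z i))\<^sup>2) + 2 * (w i * (x $ i + of_int (z' i))\<^sup>2)"
      by (simp add: algebra_simps)
  qed
  also have "\<dots> = 2 * (\<Sum>i\<in>UNIV. w i * (x $ i + of_int (z i))\<^sup>2) + 2 * (\<Sum>i\<in>UNIV. w i * (x $ i + of_int (z' i))\<^sup>2)"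
    by (simp add: sum.distrib sum_distrib_left)
  also have "\<dots> < 4 * r\<^sup>2"
    using Z(3)[OF z(1)] Z(3)[OF z(2)] by (simp add: S_def)
  finally show ?thesis using z by blast
qed

section \<open>The quartic norm forms\<close>

lemma sum_UNIV_4: "(\<Sum>i\<in>(UNIV :: 4 set). f i) = f 1 + f 2 + f 3 + f 4"
  by (rule sum_4)

lemma prod_UNIV_4: "(\<Prod>i\<in>(UNIV :: 4 set). f i) = f 1 * f 2 * f 3 * (f 4 :: 'b :: comm_monoid_mult)"
  unfolding UNIV_4 by (simp add: mult_ac)

text \<open>2 is not a square modulo 3 or 5, so both primes stay inert in the integers of
  \<open>\<rat>(\<surd>2)\<close>.\<close>

lemma dvd_norm_form_imp:
  fixes A B q :: int
  assumes q: "q = 3 \<or> q = 5" and dvd: "q dvd A\<^sup>2 - 2 * B\<^sup>2"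
  shows "q dvd A \<and> q dvd B"
proof -
  have m: "[x = x mod k] (mod k)" for x k :: int by (simp add: cong_def)
  have "[A\<^sup>2 - 2 * B\<^sup>2 = (A mod q)\<^sup>2 - 2 * (B mod q)\<^sup>2] (mod q)"
    by (intro cong_diff cong_mult cong_pow m cong_refl)
  then have 0: "((A mod q)\<^sup>2 - 2 * (B mod q)\<^sup>2) mod q = 0" using dvd by (simp only: cong_dvd_iff flip: dvd_eq_mod_eq_0)
  have "A mod 3 \<in> {0, 1, 2}" "B mod 3 \<in> {0, 1, 2}" "A mod 5 \<in> {0, 1, 2, 3, 4}" "B mod 5 \<in> {0, 1, 2, 3, 4}"
    by auto
  moreover have "\<forall>x\<in>{0, 1, 2 :: int}. \<forall>y\<in>{0, 1, 2}. (x\<^sup>2 - 2 * y\<^sup>2) mod 3 = 0 \<longrightarrow> x = 0 \<and> y = 0"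
    "\<forall>x\<in>{0, 1, 2, 3, 4 :: int}. \<forall>y\<in>{0, 1, 2, 3, 4}. (x\<^sup>2 - 2 * y\<^sup>2) mod 5 = 0 \<longrightarrow> x = 0 \<and> y = 0"
    by simp_all
  ultimately show ?thesis
    using q
  proof (elim disjE)
    assume R: "\<forall>x\<in>{0, 1, 2 :: int}. \<forall>y\<in>{0, 1, 2}. (x\<^sup>2 - 2 * y\<^sup>2) mod 3 = 0 \<longrightarrow> x = 0 \<and> y = 0"
      and AB: "A mod 3 \<in> {0, 1, 2}" "B mod 3 \<in> {0, 1, 2}" and q: "q = 3"
    from R[THEN bspec, OF AB(1), THEN bspec, OF AB(2)] show ?thesis
      using 0 unfolding q dvd_eq_mod_eq_0 by (rule mp)
  next
    assume R: "\<forall>x\<in>{0, 1, 2, 3, 4 :: int}. \<forall>y\<in>{0, 1, 2, 3, 4}. (x\<^sup>2 - 2 * y\<^sup>2) mod 5 = 0 \<longrightarrow> x = 0 \<and> y = 0"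
      and AB: "A mod 5 \<in> {0, 1, 2, 3, 4}" "B mod 5 \<in> {0, 1, 2, 3, 4}" and q: "q = 5"
    from R[THEN bspec, OF AB(1), THEN bspec, OF AB(2)] show ?thesis
      using 0 unfolding q dvd_eq_mod_eq_0 by (rule mp)
  qed
qed

lemma square_dvd_norm_form:
  fixes A B q :: int
  assumes q: "q = 3 \<or> q = 5" and dvd: "q dvd A\<^sup>2 - 2 * B\<^sup>2"
  shows "q\<^sup>2 dvd A\<^sup>2 - 2 * B\<^sup>2"
  using dvd_norm_form_imp[OF assms] by (intro dvd_diff dvd_mult dvd_power_same) auto

definition el4 :: "'a :: comm_ring_1 \<Rightarrow> int \<Rightarrow> int \<Rightarrow> int \<Rightarrow> int \<Rightarrow> 'a" where
  "el4 w a b c d = of_int a + of_int b * w + of_int c * w ^ 2 + of_int d * w ^ 3"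

text \<open>The elements of \<open>\<int>[\<zeta>\<^sub>1\<^sub>6]\<close> fixed by \<open>\<zeta>\<^sub>1\<^sub>6 \<mapsto> \<zeta>\<^sub>1\<^sub>6\<^sup>7\<close>, in the basis
  \<open>1\<close>, \<open>\<surd>2\<close>, \<open>\<alpha> = w + w\<^sup>7\<close>, \<open>\<beta> = w\<^sup>3 + w\<^sup>5 = (1 + \<surd>2) \<alpha>\<close>.\<close>

definition el8 :: "'a :: comm_ring_1 \<Rightarrow> int \<Rightarrow> int \<Rightarrow> int \<Rightarrow> int \<Rightarrow> 'a" where
  "el8 w a b c d = of_int a + of_int b * (w ^ 2 - w ^ 6) + of_int c * (w + w ^ 7) + of_int d * (w ^ 3 + w ^ 5)"

text \<open>For \<open>w\<close> a primitive 8th root of unity and \<open>x = el4 w a b c d\<close>,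
  the product of \<open>x\<close> and its conjugate is \<open>quad4 + bil4 * \<surd>2\<close>, so
  \<open>norm4\<close> is the absolute norm of \<open>x\<close>.\<close>

definition quad4 :: "int \<Rightarrow> int \<Rightarrow> int \<Rightarrow> int \<Rightarrow> int" where
  "quad4 a b c d = a\<^sup>2 + b\<^sup>2 + c\<^sup>2 + d\<^sup>2"
definition bil4 :: "int \<Rightarrow> int \<Rightarrow> int \<Rightarrow> int \<Rightarrow> int" where
  "bil4 a b c d = a * b + b * c + c * d - d * a"
definition norm4 :: "int \<Rightarrow> int \<Rightarrow> int \<Rightarrow> int \<Rightarrow> int" where
  "norm4 a b c d = (quad4 a b c d)\<^sup>2 - 2 * (bil4 a b c d)\<^sup>2"

text \<open>The same for \<open>el8\<close>, with norms from the quartic subfield.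
  \<open>quad8\<close> is also the sum of squares of the eight coefficients of \<open>el8\<close> in
  powers of \<open>w\<close>, where \<open>b\<close>, \<open>c\<close> and \<open>d\<close> each
  occur twice up to sign.\<close>

definition quad8 :: "int \<Rightarrow> int \<Rightarrow> int \<Rightarrow> int \<Rightarrow> int" where
  "quad8 a b c d = a\<^sup>2 + 2 * (b\<^sup>2 + c\<^sup>2 + d\<^sup>2)"
definition bil8 :: "int \<Rightarrow> int \<Rightarrow> int \<Rightarrow> int \<Rightarrow> int" where
  "bil8 a b c d = 2 * a * b - c\<^sup>2 + d\<^sup>2 + 2 * c * d"
definition norm8 :: "int \<Rightarrow> int \<Rightarrow> int \<Rightarrow> int \<Rightarrow> int" where
  "norm8 a b c d = (quad8 a b c d)\<^sup>2 - 2 * (bil8 a b c d)\<^sup>2"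

text \<open>The arguments are the coefficients of \<open>(1 - w) x\<close>, and \<open>1 - w\<close>
  has norm 2; compare \<open>el4_halve\<close>.\<close>

lemma norm4_halve: "norm4 (a + d) (b - a) (c - b) (d - c) = 2 * norm4 a b c d"
  by (simp add: norm4_def quad4_def bil4_def power2_eq_square algebra_simps)

text \<open>Multiplication by \<alpha>, which has norm 2; compare \<open>el8_halve\<close>.\<close>

lemma norm8_halve: "norm8 (- 2 * c) (c - d) (a - b) b = 2 * norm8 a b c d"
  by (simp add: norm8_def quad8_def bil8_def power2_eq_square algebra_simps)

text \<open>Multiplication by 1 + \<alpha>, which has norm 7; compare
  \<open>el8_seven\<close>.\<close>

lemma norm8_seven: "norm8 (a - 2 * c) (b + c - d) (c + a - b) (d + b) = 7 * norm8 a b c d"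
  by (simp add: norm8_def quad8_def bil8_def power2_eq_square algebra_simps)

text \<open>Since 3 is a square root of 2 modulo 7, the norm factors there as
  \<open>(A + 3 B) (A - 3 B)\<close>, and each factor splits into two linear forms. The four forms
  reflect the four primes above 7, which splits completely.\<close>

lemma norm8_mod_seven:
  "7 dvd norm8 a b c d - (a + 3 * b - c + 3 * d) * (a + 3 * b + c - 3 * d)
      * ((a - 3 * b - d - 3 * c) * (a - 3 * b + d + 3 * c))"
proof -
  define A B where "A = quad8 a b c d" and "B = bil8 a b c d"
  define u v where "u = (a + 3 * b - c + 3 * d) * (a + 3 * b + c - 3 * d)"
    and "v = (a - 3 * b - d - 3 * c) * (a - 3 * b + d + 3 * c)"
  have u: "A + 3 * B = u + 7 * (2 * d\<^sup>2 - b\<^sup>2)"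
    by (simp add: A_def B_def u_def quad8_def bil8_def power2_eq_square algebra_simps)
  have v: "A - 3 * B = v + 7 * (2 * c\<^sup>2 - b\<^sup>2)"
    by (simp add: A_def B_def v_def quad8_def bil8_def power2_eq_square algebra_simps)
  have "norm8 a b c d = (A + 3 * B) * (A - 3 * B) + 7 * B\<^sup>2"
    by (simp add: norm8_def A_def B_def power2_eq_square algebra_simps)
  then have "norm8 a b c d - u * v = 7 * ((2 * d\<^sup>2 - b\<^sup>2) * v + u * (2 * c\<^sup>2 - b\<^sup>2)
      + 7 * (2 * d\<^sup>2 - b\<^sup>2) * (2 * c\<^sup>2 - b\<^sup>2) + B\<^sup>2)"
    unfolding u v by (simp add: algebra_simps)
  then have "7 dvd norm8 a b c d - u * v" by (simp only: dvd_triv_left)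
  then show ?thesis by (simp only: u_def v_def)
qed

text \<open>3 is inert in the quartic field; verified by running through all residues modulo
  3.\<close>

lemma norm8_inert_three:
  assumes "3 dvd norm8 a b c d"
  shows "3 dvd a \<and> 3 dvd b \<and> 3 dvd c \<and> 3 dvd d"
proof -
  have "3 dvd quad8 a b c d" "3 dvd bil8 a b c d"
    using dvd_norm_form_imp[OF disjI1[OF refl] assms[unfolded norm8_def]] by simp_all
  moreover have m: "[x = x mod 3] (mod 3)" for x :: int by (simp add: cong_def)
  have "[quad8 a b c d = quad8 (a mod 3) (b mod 3) (c mod 3) (d mod 3)] (mod 3)"
    "[bil8 a b c d = bil8 (a mod 3) (b mod 3) (c mod 3) (d mod 3)] (mod 3)"
    unfolding quad8_def bil8_def by (intro cong_add cong_diff cong_mult cong_pow m cong_refl)+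
  ultimately have 0: "quad8 (a mod 3) (b mod 3) (c mod 3) (d mod 3) mod 3 = 0"
     "bil8 (a mod 3) (b mod 3) (c mod 3) (d mod 3) mod 3 = 0" by (simp_all only: cong_dvd_iff flip: dvd_eq_mod_eq_0)
  have "x mod 3 \<in> {0, 1, 2}" for x :: int by auto
  then have mem: "a mod 3 \<in> {0, 1, 2}" "b mod 3 \<in> {0, 1, 2}" "c mod 3 \<in> {0, 1, 2}" "d mod 3 \<in> {0, 1, 2}"
    by blast+
  have R: "\<forall>a\<in>{0, 1, 2}. \<forall>b\<in>{0, 1, 2}. \<forall>c\<in>{0, 1, 2}. \<forall>d\<in>{0, 1, 2}.
      quad8 a b c d mod 3 = 0 \<longrightarrow> bil8 a b c d mod 3 = 0 \<longrightarrow> a = 0 \<and> b = 0 \<and> c = 0 \<and> d = 0"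
    by (simp add: quad8_def bil8_def)
  show ?thesis
    unfolding dvd_eq_mod_eq_0
    by (rule R[THEN bspec, OF mem(1), THEN bspec, OF mem(2), THEN bspec, OF mem(3), THEN bspec, OF mem(4), rule_format, OF 0])
qed

section \<open>Multiplication tables for the quartic elements and their conjugates\<close>

context
  fixes w :: "'a :: comm_ring_1"
  assumes w4: "w ^ 4 = -1"
begin

lemma w4_rules: "w * (w * (w * w)) = -1" "w * (w * (w * (w * x))) = - x"
  using w4 by (simp_all add: power_numeral_reduce flip: mult.assoc)

lemma el4_halve: "el4 w (a + d) (b - a) (c - b) (d - c) = (1 - w) * el4 w a b c d"
  by (simp add: el4_def eval_nat_numeral algebra_simps w4_rules)

lemma el4_sqrt2: "el4 w (b - d) (a + c) (b + d) (c - a) = (w - w ^ 3) * el4 w a b c d"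
  by (simp add: el4_def eval_nat_numeral algebra_simps w4_rules)

end

context
  fixes w :: "'a :: comm_ring_1"
  assumes w8: "w ^ 8 = -1"
begin

lemma w8_rules: "w * (w * (w * (w * (w * (w * (w * w)))))) = -1"
    "w * (w * (w * (w * (w * (w * (w * (w * x))))))) = - x"
  using w8 by (simp_all add: power_numeral_reduce flip: mult.assoc)

lemma el8_halve: "el8 w (- 2 * c) (c - d) (a - b) b = (w + w ^ 7) * el8 w a b c d"
  by (simp add: el8_def eval_nat_numeral algebra_simps w8_rules)

lemma el8_seven: "el8 w (a - 2 * c) (b + c - d) (c + a - b) (d + b) = (1 + (w + w ^ 7)) * el8 w a b c d"
  by (simp add: el8_def eval_nat_numeral algebra_simps w8_rules)

lemma el8_sqrt2: "el8 w (2 * b) a (d - c) (c + d) = (w ^ 2 - w ^ 6) * el8 w a b c d"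
  by (simp add: el8_def eval_nat_numeral algebra_simps w8_rules)

lemma el8_uminus: "el8 (- w) a b c d = el8 w a b (- c) (- d)"
  by (simp add: el8_def algebra_simps)

lemma el8_cube: "el8 (w ^ 3) a b c d = el8 w a (- b) (- d) c"
  by (simp add: el8_def eval_nat_numeral algebra_simps w8_rules)

text \<open>\<alpha> divides 2, which keeps it out of \<open>P\<close> when \<open>p\<close> is
  odd.\<close>

lemma el8_prime_two: "(w + w ^ 7) * ((w + w ^ 7) * (- 2 - w ^ 2 + w ^ 6)) = 2"
  by (simp add: eval_nat_numeral algebra_simps w8_rules)

lemma el8_conv_sum:
  "el8 w a b c d = (\<Sum>i<8. of_int ([a, c, b, d, 0, d, - b, c] ! i) * w ^ i)"
  by (simp add: el8_def eval_nat_numeral algebra_simps)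

lemma el8_power7:
  "(\<Sum>i<8. of_int ([a, c, b, d, 0, d, - b, c] ! i) * (w ^ 7) ^ i) = el8 w a b c d"
proof -
  have "w ^ (8 * j + k) = (-1) ^ j * w ^ k" for j k using w8 by (simp add: power_add power_mult)
  from this[of 1 6] this[of 2 5] this[of 3 4] this[of 4 3] this[of 5 2] this[of 6 1]
  have "w ^ 14 = - (w ^ 6)" "w ^ 21 = w ^ 5" "w ^ 35 = w ^ 3" "w ^ 42 = - (w ^ 2)" "w ^ 49 = w"
    by simp_all
  note pw = this
  have expand: "(\<Sum>i<8. of_int ([a, c, b, d, 0, d, - b, c] ! i) * u ^ i) = of_int a + of_int c * u
      + of_int b * u ^ 2 + of_int d * u ^ 3 + of_int d * u ^ 5 - of_int b * u ^ 6 + of_int c * u ^ 7" for u :: 'a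
    by (simp add: eval_nat_numeral algebra_simps)
  show ?thesis
    unfolding expand by (simp add: el8_def algebra_simps pw flip: power_mult)
qed

end

section \<open>Short elements of the prime ideal\<close>

context prime_ideal_over
begin

text \<open>By \<open>int_residue\<close> every value of \<open>g\<close> is congruent to one of
  \<open>p\<close> integers, so the quadruples with \<open>g\<close> in \<open>P\<close> can be
  reached by the pigeonhole version of Minkowski's theorem with weights
  \<open>1, v, v, v\<close>.\<close>

lemma short_quadruple:
  fixes g :: "int \<Rightarrow> int \<Rightarrow> int \<Rightarrow> int \<Rightarrow> 'a" and v K :: int
  assumes diff: "\<And>a b c d a' b' c' d'. g (a - a') (b - b') (c - c') (d - d') = g a b c d - g a' b' c' d'"
    and gR: "\<And>a b c d. g a b c d \<in> R"
    and frob: "\<And>a b c d. g a b c d ^ p - g a b c d \<in> P"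
    and v: "v > 0" and K: "K > 0" "pi\<^sup>2 * real_of_int K > 32 * sqrt (real_of_int v) ^ 3"
  shows "\<exists>a b c d. g a b c d \<in> P \<and> a\<^sup>2 + v * (b\<^sup>2 + c\<^sup>2 + d\<^sup>2) > 0
    \<and> (a\<^sup>2 + v * (b\<^sup>2 + c\<^sup>2 + d\<^sup>2))\<^sup>2 < K * int p"
proof -
  have p0: "p > 0" using prime_p by (simp add: prime_gt_0_nat)
  define T where "T = sqrt (real_of_int K * real p)"
  have T: "T > 0" "T\<^sup>2 = real_of_int K * real p" using K(1) p0 by (simp_all add: T_def)
  \<comment> \<open>With \<open>4 * r\<^sup>2 = T\<close> the volume condition
    \<open>pi\<^sup>2 / 2 * r ^ 4 > p * sqrt v ^ 3\<close> becomes the hypothesis on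
    \<open>K\<close>.\<close>
  define r where "r = sqrt T / 2"
  have r: "r > 0" "4 * r\<^sup>2 = T" using T(1) by (simp_all add: r_def power_divide)
  have r4: "16 * r ^ 4 = real_of_int K * real p"
  proof -
    have "16 * r ^ 4 = (4 * r\<^sup>2)\<^sup>2" by (simp add: power_mult_distrib flip: power_mult)
    then show ?thesis using r T by simp
  qed
  define w :: "4 \<Rightarrow> real" where "w i = (if i = 1 then 1 else real_of_int v)" for i
  have w: "w 1 = 1" "w 2 = real_of_int v" "w 3 = real_of_int v" "w 4 = real_of_int v"
    by (simp_all add: w_def)
  have w0: "w i > 0" for i
  proof -
    have "\<forall>i. w i > 0" unfolding forall_4 using v by (simp add: w)
    then show ?thesis by blast
  qed
  define gz where "gz z = g (z 1) (z 2) (z 3) (z (4 :: 4))" for z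
  define cls where "cls z = (SOME j. j < p \<and> gz z - of_nat j \<in> P)" for z
  have cls: "cls z < p \<and> gz z - of_nat (cls z) \<in> P" for z
    unfolding cls_def by (rule someI_ex, rule int_residue) (simp_all add: gz_def gR frob)
  have "real p * (32 * sqrt (real_of_int v) ^ 3) < real p * (pi\<^sup>2 * real_of_int K)"
    using K p0 by (intro mult_strict_left_mono) auto
  also have "\<dots> = pi\<^sup>2 * (16 * r ^ 4)" unfolding r4 by (simp add: mult_ac)
  finally have "real p * sqrt (real_of_int v) ^ 3 < pi\<^sup>2 / 2 * r ^ 4" by (simp add: field_simps)
  then have vol: "real (card {..<p}) * (\<Prod>i\<in>UNIV. sqrt (w i)) < unit_ball_vol (real CARD(4)) * r ^ CARD(4)"
    by (simp add: prod_UNIV_4 w unit_ball_vol_4 power3_eq_cube mult_ac)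
  from minkowski_residue_classes[of w r cls "{..<p}", OF w0 r(1) _ _ vol]
  obtain z z' where z: "z \<noteq> z'" "cls z = cls z'"
    and small: "(\<Sum>i\<in>UNIV. w i * (real_of_int (z i - z' i))\<^sup>2) < 4 * r\<^sup>2"
    using cls by auto
  define a b c d where "a = z 1 - z' 1" and "b = z 2 - z' 2" and "c = z 3 - z' 3" and "d = z 4 - z' 4"
  have "g a b c d = gz z - gz z'" by (simp add: gz_def a_def b_def c_def d_def diff)
  also have "\<dots> = (gz z - of_nat (cls z)) - (gz z' - of_nat (cls z'))" using z by simp
  also have "\<dots> \<in> P" using cls[of z] cls[of z'] by (blast intro: diff_P)
  finally have gP: "g a b c d \<in> P" .
  define q where "q = a\<^sup>2 + v * (b\<^sup>2 + c\<^sup>2 + d\<^sup>2)"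
  have "real_of_int q < T"
    using small by (simp add: sum_UNIV_4 w r a_def b_def c_def d_def q_def algebra_simps)
  moreover have q: "q > 0"
  proof -
    have "\<exists>i. z i \<noteq> z' i" using z(1) by auto
    then have "\<not> (\<forall>i. z i = z' i)" by simp
    then have ne: "\<not> (a = 0 \<and> b = 0 \<and> c = 0 \<and> d = 0)" unfolding forall_4 by (simp add: a_def b_def c_def d_def)
    have "b\<^sup>2 + c\<^sup>2 + d\<^sup>2 \<ge> 0" by simp
    then have nn: "v * (b\<^sup>2 + c\<^sup>2 + d\<^sup>2) \<ge> 0" using v by simp
    have "q \<noteq> 0"
    proof
      assume "q = 0"
      then have "a\<^sup>2 = 0" "v * (b\<^sup>2 + c\<^sup>2 + d\<^sup>2) = 0"
        using nn zero_le_power2[of a] unfolding q_def by linarith+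
      then have "a\<^sup>2 = 0" "b\<^sup>2 + c\<^sup>2 + d\<^sup>2 = 0" using v by simp_all
      then have "a\<^sup>2 = 0" "b\<^sup>2 = 0" "c\<^sup>2 = 0" "d\<^sup>2 = 0"
        using zero_le_power2[of b] zero_le_power2[of c] zero_le_power2[of d] by linarith+
      then show False using ne by simp
    qed
    then show ?thesis using nn zero_le_power2[of a] unfolding q_def by linarith
  qed
  ultimately have "(real_of_int q)\<^sup>2 < T\<^sup>2" by (intro power_strict_mono) auto
  also have "T\<^sup>2 = real_of_int (K * int p)" by (simp add: T)
  finally have "real_of_int (q\<^sup>2) < real_of_int (K * int p)" by simp
  then have "q\<^sup>2 < K * int p" by (simp only: of_int_less_iff)
  then show ?thesis using gP q unfolding q_def by blast
qed

lemma norm_form_in_P: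
  assumes "s \<in> R" "s\<^sup>2 = 2" "of_int A + of_int B * s \<in> P"
  shows "int p dvd A\<^sup>2 - 2 * B\<^sup>2"
proof -
  have "(of_int A + of_int B * s) * (of_int A - of_int B * s) \<in> P"
    using assms by (intro mult_P_right) (auto intro!: closed_R)
  also have "(of_int A + of_int B * s) * (of_int A - of_int B * s) = of_int A ^ 2 - of_int B ^ 2 * s\<^sup>2"
    by (simp add: power2_eq_square algebra_simps)
  also have "\<dots> = of_int (A\<^sup>2 - 2 * B\<^sup>2)" by (simp add: assms(2))
  finally show ?thesis by (simp only: of_int_in_P_iff)
qed

lemma two_notin_P: "odd p \<Longrightarrow> 2 \<notin> P"
proof -
  assume "odd p"
  then have "\<not> int p dvd 2"
    using prime_gt_1_nat[OF prime_p] zdvd_imp_le[of "int p" 2] by (cases "p = 2") auto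
  then show ?thesis using of_int_in_P_iff[of 2] by simp
qed

end

section \<open>Positivity of the norm forms and their change under the units\<close>

lemma sqrt2_abs_le_iff:
  fixes A B :: int
  assumes "A \<ge> 0"
  shows "2 * B\<^sup>2 \<le> A\<^sup>2 \<longleftrightarrow> sqrt 2 * \<bar>real_of_int B\<bar> \<le> real_of_int A"
proof -
  have "sqrt 2 * \<bar>real_of_int B\<bar> \<le> real_of_int A \<longleftrightarrow> (sqrt 2 * \<bar>real_of_int B\<bar>)\<^sup>2 \<le> (real_of_int A)\<^sup>2"
    using assms by (intro power_mono_iff[symmetric]) auto
  also have "\<dots> \<longleftrightarrow> real_of_int (2 * B\<^sup>2) \<le> real_of_int (A\<^sup>2)"
    by (simp add: power_mult_distrib)
  finally show ?thesis by (simp only: of_int_le_iff)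
qed

text \<open>The hypothesis says \<open>\<surd>2 * \<bar>B j\<bar> \<le> A j\<close>, a condition
  that survives summation by the triangle inequality.\<close>

lemma double_square_le_sum:
  fixes A B :: "'b \<Rightarrow> int"
  assumes "\<And>j. j \<in> J \<Longrightarrow> A j \<ge> 0" "\<And>j. j \<in> J \<Longrightarrow> 2 * (B j)\<^sup>2 \<le> (A j)\<^sup>2"
  shows "2 * (\<Sum>j\<in>J. B j)\<^sup>2 \<le> (\<Sum>j\<in>J. A j)\<^sup>2"
proof -
  have "sqrt 2 * \<bar>real_of_int (\<Sum>j\<in>J. B j)\<bar> \<le> sqrt 2 * (\<Sum>j\<in>J. \<bar>real_of_int (B j)\<bar>)"
    by (intro mult_left_mono) (auto simp: sum_abs)
  also have "\<dots> = (\<Sum>j\<in>J. sqrt 2 * \<bar>real_of_int (B j)\<bar>)" by (rule sum_distrib_left)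
  also have "\<dots> \<le> (\<Sum>j\<in>J. real_of_int (A j))"
    using assms by (intro sum_mono) (simp flip: sqrt2_abs_le_iff)
  also have "\<dots> = real_of_int (\<Sum>j\<in>J. A j)" by simp
  finally show ?thesis using assms(1) by (subst sqrt2_abs_le_iff) (auto intro: sum_nonneg)
qed

lemma double_square_le_add:
  fixes A B A' B' :: int
  assumes "A \<ge> 0" "A' \<ge> 0" "2 * B\<^sup>2 \<le> A\<^sup>2" "2 * B'\<^sup>2 \<le> A'\<^sup>2"
  shows "2 * (B + B')\<^sup>2 \<le> (A + A')\<^sup>2"
  using double_square_le_sum[of "UNIV :: bool set" "\<lambda>b. if b then A else A'" "\<lambda>b. if b then B else B'"] assms
  by (simp add: UNIV_bool add.commute)

lemma norm_form_pos:
  fixes A B :: int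
  assumes "A > 0" "2 * B\<^sup>2 \<le> A\<^sup>2"
  shows "A\<^sup>2 - 2 * B\<^sup>2 > 0"
proof -
  have "A\<^sup>2 \<noteq> 2 * B\<^sup>2" using square_eq_prime_times_square[of 2 A B] assms(1) by force
  then show ?thesis using assms(2) by linarith
qed

lemma quad4_conv: "quad4 a b c d = sq4 ((!) [a, b, c, d])" "bil4 a b c d = cross4 ((!) [a, b, c, d])"
  by (simp_all add: quad4_def bil4_def sq4_def cross4_def eval_nat_numeral)

lemma quad8_conv:
  "quad8 a b c d = sq4 ((!) [a, b, 0, - b]) + sq4 ((!) [c, d, d, c])"
  "bil8 a b c d = cross4 ((!) [a, b, 0, - b]) + cross4 ((!) [c, d, d, c])"
  by (simp_all add: quad8_def bil8_def sq4_def cross4_def eval_nat_numeral algebra_simps)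

lemma el4_conv_sum: "el4 w a b c d = (\<Sum>i<4. of_int ([a, b, c, d] ! i) * w ^ i)"
  by (simp add: el4_def eval_nat_numeral algebra_simps)

lemma norm4_pos: "quad4 a b c d > 0 \<Longrightarrow> norm4 a b c d > 0"
  unfolding norm4_def by (rule norm_form_pos) (simp_all only: quad4_conv cross4_bound)

lemma norm8_pos: "quad8 a b c d > 0 \<Longrightarrow> norm8 a b c d > 0"
  unfolding norm8_def
  by (rule norm_form_pos) (simp_all only: quad8_conv double_square_le_add sq4_nonneg cross4_bound)

lemma quad4_nonneg: "quad4 a b c d \<ge> 0"
  by (simp add: quad4_def)

lemma quad8_nonneg: "quad8 a b c d \<ge> 0"
  by (simp add: quad8_def)

lemma quad4_pos_if: "norm4 a b c d > 0 \<Longrightarrow> quad4 a b c d > 0"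
  using quad4_nonneg[of a b c d] zero_le_power2[of "bil4 a b c d"]
  by (cases "quad4 a b c d = 0") (auto simp: norm4_def)

lemma quad8_pos_if: "norm8 a b c d > 0 \<Longrightarrow> quad8 a b c d > 0"
  using quad8_nonneg[of a b c d] zero_le_power2[of "bil8 a b c d"]
  by (cases "quad8 a b c d = 0") (auto simp: norm8_def)

text \<open>The arguments are the coefficients of \<open>x\<close> times
  \<open>1 \<plusminus> \<surd>2\<close>, so \<open>A + B \<surd>2\<close> gets multiplied by the
  square \<open>3 \<plusminus> 2 \<surd>2\<close>.\<close>

lemma pell_step4:
  "quad4 (a + (b - d)) (b + (a + c)) (c + (b + d)) (d + (c - a)) = 3 * quad4 a b c d + 4 * bil4 a b c d"
  "bil4 (a + (b - d)) (b + (a + c)) (c + (b + d)) (d + (c - a)) = 3 * bil4 a b c d + 2 * quad4 a b c d"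
  "quad4 (a - (b - d)) (b - (a + c)) (c - (b + d)) (d - (c - a)) = 3 * quad4 a b c d - 4 * bil4 a b c d"
  "bil4 (a - (b - d)) (b - (a + c)) (c - (b + d)) (d - (c - a)) = 3 * bil4 a b c d - 2 * quad4 a b c d"
  by (simp_all add: quad4_def bil4_def power2_eq_square algebra_simps)

lemma pell_step8:
  "quad8 (a + 2 * b) (b + a) (c + (d - c)) (d + (c + d)) = 3 * quad8 a b c d + 4 * bil8 a b c d"
  "bil8 (a + 2 * b) (b + a) (c + (d - c)) (d + (c + d)) = 3 * bil8 a b c d + 2 * quad8 a b c d"
  "quad8 (a - 2 * b) (b - a) (c - (d - c)) (d - (c + d)) = 3 * quad8 a b c d - 4 * bil8 a b c d"
  "bil8 (a - 2 * b) (b - a) (c - (d - c)) (d - (c + d)) = 3 * bil8 a b c d - 2 * quad8 a b c d"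
  by (simp_all add: quad8_def bil8_def power2_eq_square algebra_simps)

lemma pell_step_norm:
  fixes A B :: int
  shows "(3 * A + 4 * B)\<^sup>2 - 2 * (3 * B + 2 * A)\<^sup>2 = A\<^sup>2 - 2 * B\<^sup>2"
    "(3 * A - 4 * B)\<^sup>2 - 2 * (3 * B - 2 * A)\<^sup>2 = A\<^sup>2 - 2 * B\<^sup>2"
  by (simp_all add: power2_eq_square algebra_simps)

lemma el4_add: "el4 w (a + a') (b + b') (c + c') (d + d') = el4 w a b c d + el4 w a' b' c' d'"
  by (simp add: el4_def algebra_simps)

lemma el4_diff: "el4 w (a - a') (b - b') (c - c') (d - d') = el4 w a b c d - el4 w a' b' c' d'"
  by (simp add: el4_def algebra_simps)

lemma el8_add: "el8 w (a + a') (b + b') (c + c') (d + d') = el8 w a b c d + el8 w a' b' c' d'"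
  by (simp add: el8_def algebra_simps)

lemma el8_diff: "el8 w (a - a') (b - b') (c - c') (d - d') = el8 w a b c d - el8 w a' b' c' d'"
  by (simp add: el8_def algebra_simps)

context prime_ideal_over
begin

lemma el4_R: "w \<in> R \<Longrightarrow> el4 w a b c d \<in> R"
  unfolding el4_def by (auto intro!: closed_R)

lemma el8_R: "w \<in> R \<Longrightarrow> el8 w a b c d \<in> R"
  unfolding el8_def by (auto intro!: closed_R)

lemma el4_norm_dvd:
  assumes w: "w \<in> R" "w ^ 4 = -1" and el: "el4 w a b c d \<in> P"
  shows "int p dvd norm4 a b c d"
  unfolding norm4_def quad4_conv
proof (rule norm_form_in_P)
  show "w - w ^ 3 \<in> R" using w by (auto intro!: closed_R)
  show "(w - w ^ 3)\<^sup>2 = 2" using w(2) by (rule sqrt2_cyclotomic8)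
  show "of_int (sq4 ((!) [a, b, c, d])) + of_int (cross4 ((!) [a, b, c, d])) * (w - w ^ 3) \<in> P"
    using el unfolding el4_conv_sum by (rule block4_in_P[OF w])
qed

lemma el8_norm_dvd:
  assumes w: "w \<in> R" "w ^ 8 = -1" and p: "p mod 16 = 7" and el: "el8 w a b c d \<in> P"
  shows "int p dvd norm8 a b c d"
  unfolding norm8_def
proof (rule norm_form_in_P)
  show "w\<^sup>2 - (w\<^sup>2) ^ 3 \<in> R" using w by (auto intro!: closed_R)
  show "(w\<^sup>2 - (w\<^sup>2) ^ 3)\<^sup>2 = 2" using w(2) by (intro sqrt2_cyclotomic8) (simp flip: power_mult)
  have "sq4 (\<lambda>i. [a, c, b, d, 0, d, - b, c] ! (2 * i)) + sq4 (\<lambda>i. [a, c, b, d, 0, d, - b, c] ! (1 + 2 * i)) = quad8 a b c d"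
    "cross4 (\<lambda>i. [a, c, b, d, 0, d, - b, c] ! (2 * i)) + cross4 (\<lambda>i. [a, c, b, d, 0, d, - b, c] ! (1 + 2 * i)) = bil8 a b c d"
    by (simp_all add: quad8_def bil8_def sq4_def cross4_def eval_nat_numeral algebra_simps)
  then show "of_int (quad8 a b c d) + of_int (bil8 a b c d) * (w\<^sup>2 - (w\<^sup>2) ^ 3) \<in> P"
    using block8_in_P[OF w _ p, of "(!) [a, c, b, d, 0, d, - b, c]"] el
    unfolding el8_conv_sum[OF w(2)] by simp
qed

lemma el4_frobenius:
  assumes w: "w \<in> R" "w ^ 4 = -1" and p: "p mod 8 = 1"
  shows "el4 w a b c d ^ p - el4 w a b c d \<in> P"
proof -
  have "p = 4 * (2 * (p div 8)) + 1" using p by presburger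
  then have "w ^ p = w ^ (4 * (2 * (p div 8)) + 1)" by (rule arg_cong)
  also have "\<dots> = ((w ^ 4)\<^sup>2) ^ (p div 8) * w" by (simp only: power_add power_mult power_one_right)
  also have "\<dots> = w" by (simp only: w(2)) simp
  finally have "w ^ p = w" .
  then show ?thesis
    using frobenius_sum[OF w(1), of "(!) [a, b, c, d]" 4] unfolding el4_conv_sum by simp
qed

lemma el8_frobenius:
  assumes w: "w \<in> R" "w ^ 8 = -1" and p: "p mod 16 = 7"
  shows "el8 w a b c d ^ p - el8 w a b c d \<in> P"
proof -
  have "p = 8 * (2 * (p div 16)) + 7" using p by presburger
  then have "w ^ p = w ^ (8 * (2 * (p div 16)) + 7)" by (rule arg_cong)
  also have "\<dots> = ((w ^ 8)\<^sup>2) ^ (p div 16) * w ^ 7" by (simp only: power_add power_mult)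
  also have "\<dots> = w ^ 7" by (simp only: w(2)) simp
  finally have "w ^ p = w ^ 7" .
  then show ?thesis
    using frobenius_sum[OF w(1), of "(!) [a, c, b, d, 0, d, - b, c]" 8]
    unfolding el8_conv_sum[OF w(2), symmetric] by (simp only: el8_power7[OF w(2)])
qed

text \<open>An even norm means that \<open>a + b + c + d\<close> is even, which is divisibility by
  \<open>1 - w\<close>. That element divides 2, hence is outside \<open>P\<close>, and the quotient
  stays in \<open>P\<close>.\<close>

lemma el4_descent_two:
  assumes w: "w \<in> R" "w ^ 4 = -1" and p: "odd p"
    and el: "el4 w a b c d \<in> P" and norm: "norm4 a b c d = 2 * k"
  shows "\<exists>a b c d. el4 w a b c d \<in> P \<and> norm4 a b c d = k"
proof -
  have "even (norm4 a b c d)" using norm by simp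
  then have "even (a + b + c + d)" by (simp add: norm4_def quad4_def)
  then obtain s where s: "a + b + c + d = 2 * s" by (rule evenE)
  \<comment> \<open>The quotient has coefficients \<open>a', b', c', s\<close>, found by solving the
    equations of \<open>el4_halve\<close>.\<close>
  define b' c' where "b' = s - d - c" and "c' = s - d"
  define a' where "a' = s - d - c - b"
  have eqs: "a' + s = a" "b' - a' = b" "c' - b' = c" "s - c' = d"
    using s by (simp_all add: a'_def b'_def c'_def)
  have "(1 - w) * el4 w a' b' c' s \<in> P"
    using el el4_halve[OF w(2), of a' s b' c'] by (simp add: eqs)
  moreover have "1 - w \<notin> P"
  proof
    assume "1 - w \<in> P"
    then have "(1 - w) * (1 + w + w ^ 2 + w ^ 3) \<in> P"
      using w by (intro mult_P_right) (auto intro!: closed_R)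
    also have "(1 - w) * (1 + w + w ^ 2 + w ^ 3) = 1 - w ^ 4" by (simp add: eval_nat_numeral algebra_simps)
    finally show False using two_notin_P[OF p] w by simp
  qed
  ultimately have "el4 w a' b' c' s \<in> P"
    using prime_P[of "1 - w" "el4 w a' b' c' s"] w by (auto intro!: closed_R el4_R)
  moreover have "norm4 a' b' c' s = k"
    using norm norm4_halve[of a' s b' c'] by (simp add: eqs)
  ultimately show ?thesis by blast
qed

text \<open>An even norm forces \<open>a\<close> to be even, which is divisibility by \<alpha>;
  \<alpha> lies outside \<open>P\<close>, so the quotient stays in \<open>P\<close>.\<close>

lemma el8_descent_two:
  assumes w: "w \<in> R" "w ^ 8 = -1" and p: "odd p"
    and el: "el8 w a b c d \<in> P" and norm: "norm8 a b c d = 2 * k"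
  shows "\<exists>a b c d. el8 w a b c d \<in> P \<and> norm8 a b c d = k"
proof -
  have "even (norm8 a b c d)" using norm by simp
  then have "even a" by (simp add: norm8_def quad8_def)
  then obtain s where s: "a = 2 * s" by (rule evenE)
  have eqs: "- 2 * - s = a" "- s - (- s - b) = b" "(c + d) - d = c"
    using s by simp_all
  have "(w + w ^ 7) * el8 w (c + d) d (- s) (- s - b) \<in> P"
    using el el8_halve[OF w(2), of "- s" "- s - b" "c + d" d] unfolding eqs by simp
  moreover have "w + w ^ 7 \<notin> P"
  proof
    assume "w + w ^ 7 \<in> P"
    then have "(w + w ^ 7) * ((w + w ^ 7) * (- 2 - w ^ 2 + w ^ 6)) \<in> P"
      using w of_int_R[of "-2"] by (intro mult_P_right) (auto intro!: closed_R)
    then show False using two_notin_P[OF p] unfolding el8_prime_two[OF w(2)] by simp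
  qed
  ultimately have "el8 w (c + d) d (- s) (- s - b) \<in> P"
    using prime_P[of "w + w ^ 7" "el8 w (c + d) d (- s) (- s - b)"] w by (auto intro!: closed_R el8_R)
  moreover have "norm8 (c + d) d (- s) (- s - b) = k"
    using norm norm8_halve[of "- s" "- s - b" "c + d" d] unfolding eqs by simp
  ultimately show ?thesis by blast
qed

end

section \<open>Elements of norm exactly p in the prime ideal\<close>

context prime_ideal_over
begin

lemma p_not_small: "q = 3 \<or> q = 5 \<Longrightarrow> p mod 16 = 7 \<or> p mod 16 = 9 \<Longrightarrow> \<not> q dvd int p"
proof
  assume q: "q = 3 \<or> q = 5" and p: "p mod 16 = 7 \<or> p mod 16 = 9" and "q dvd int p"
  then have "nat q dvd p" by (auto simp: int_dvd_int_iff[symmetric])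
  moreover have "nat q \<noteq> 1" using q by auto
  ultimately have "p = nat q" using prime_p by (auto simp: prime_nat_iff)
  then show False using p q by auto
qed

text \<open>The inert primes 3 and 5 cannot divide a norm from \<open>\<rat>(\<surd>2)\<close>
  exactly once.\<close>

lemma norm_multiple_excluded:
  assumes pm: "p mod 16 = 7 \<or> p mod 16 = 9" and q: "q = 3 \<or> q = 5"
    and k: "q dvd k" "\<not> q\<^sup>2 dvd k" and norm: "A\<^sup>2 - 2 * B\<^sup>2 = k * int p"
  shows False
proof -
  have "q\<^sup>2 dvd k * int p"
    using square_dvd_norm_form[OF q, of A B] k(1) norm by simp
  moreover have "prime q" using q by auto
  then have "coprime q (int p)"
    using p_not_small[OF q pm] by (intro prime_imp_coprime) auto
  then have "coprime (q\<^sup>2) (int p)" by simp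
  ultimately show False using k(2) by (simp add: coprime_dvd_mult_left_iff)
qed

lemma exists_el4_norm_p:
  assumes w: "w \<in> R" "w ^ 4 = -1" and p: "p mod 16 = 9"
  shows "\<exists>a b c d. el4 w a b c d \<in> P \<and> norm4 a b c d = int p"
proof -
  have p8: "p mod 8 = 1" and odd: "odd p" using p by presburger+
  have p0: "int p > 0" using p by (cases "p = 0") auto
  \<comment> \<open>For weight 1 the Minkowski condition holds with \<open>K = 4\<close>, since 32 <
    36; this limits the cofactor \<open>k\<close> to 1, 2, 3.\<close>
  have "32 * sqrt (real_of_int 1) ^ 3 < 3\<^sup>2 * real_of_int 4" by simp
  also have "\<dots> \<le> pi\<^sup>2 * real_of_int 4"
    using pi_approx by (intro mult_right_mono power_mono) auto
  finally have "\<exists>a b c d. el4 w a b c d \<in> P \<and> a\<^sup>2 + 1 * (b\<^sup>2 + c\<^sup>2 + d\<^sup>2) > 0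
      \<and> (a\<^sup>2 + 1 * (b\<^sup>2 + c\<^sup>2 + d\<^sup>2))\<^sup>2 < 4 * int p"
    by (intro short_quadruple el4_diff el4_R el4_frobenius w p8) auto
  then obtain a b c d where el: "el4 w a b c d \<in> P"
    and q: "quad4 a b c d > 0" "(quad4 a b c d)\<^sup>2 < 4 * int p"
    by (auto simp: quad4_def add.assoc)
  obtain k where "norm4 a b c d = int p * k" using el4_norm_dvd[OF w el] by (rule dvdE)
  then have k: "norm4 a b c d = k * int p" by simp
  have "norm4 a b c d \<le> (quad4 a b c d)\<^sup>2" by (simp add: norm4_def)
  then have "k * int p < 4 * int p" using q(2) unfolding k by linarith
  moreover have "0 < k * int p" using norm4_pos[OF q(1)] unfolding k .
  ultimately have "0 < k" "k < 4"
    using p0 by (simp_all only: mult_less_cancel_right_pos zero_less_mult_pos2)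
  then have "k = 1 \<or> k = 2 \<or> k = 3" by linarith
  then show ?thesis
  proof (elim disjE)
    assume "k = 1"
    then show ?thesis using el k by auto
  next
    assume "k = 2"
    then show ?thesis using el4_descent_two[OF w odd el, of "int p"] k by simp
  next
    assume "k = 3"
    then show ?thesis
      using norm_multiple_excluded[of 3 3 "quad4 a b c d" "bil4 a b c d"] k p by (simp add: norm4_def)
  qed
qed

text \<open>Any element of norm \<open>7 p\<close> is divisible by one of the four conjugates of \<open>1 + \<alpha>\<close>.\<close>

lemma el8_descent_seven_aux:
  assumes w: "w \<in> R" "w ^ 8 = -1" and p: "p mod 16 = 7"
    and el: "el8 w a b c d \<in> P" and norm: "norm8 a b c d = 7 * int p"
    and dvd: "7 dvd a + 3 * b - c + 3 * d"
  shows "\<exists>a b c d. el8 w a b c d \<in> P \<and> norm8 a b c d = int p"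
proof (cases "1 + (w + w ^ 7) \<in> P")
  case True
  \<comment> \<open>In this case \<open>p = 7\<close>, and 1 + \<alpha> itself is the required
    element.\<close>
  then have "el8 w 1 0 1 0 \<in> P" by (simp add: el8_def)
  moreover have "norm8 1 0 1 0 = 7" by (simp add: norm8_def quad8_def bil8_def)
  moreover from this have "int p dvd 7" using el8_norm_dvd[OF w p \<open>el8 w 1 0 1 0 \<in> P\<close>] by simp
  then have "p dvd 7" by (metis int_dvd_int_iff of_nat_numeral)
  then have "p \<le> 7" by (auto dest: dvd_imp_le)
  then have "p = 7" using p by auto
  ultimately show ?thesis by (metis of_nat_numeral)
next
  case False
  obtain s where s: "a + 3 * b - c + 3 * d = 7 * s" using dvd by (rule dvdE)
  \<comment> \<open>The quotient by 1 + \<alpha> has coefficients \<open>a', s, c', d'\<close>,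
    found by solving the equations of \<open>el8_seven\<close>.\<close>
  define a' c' d' where "a' = 3 * s - b + c - d" and "c' = b + d - 2 * s" and "d' = d - s"
  have eqs: "a' - 2 * c' = a" "s + c' - d' = b" "c' + a' - s = c" "d' + s = d"
    using s by (simp_all add: a'_def c'_def d'_def)
  have "(1 + (w + w ^ 7)) * el8 w a' s c' d' \<in> P"
    using el el8_seven[OF w(2), of a' c' s d'] unfolding eqs by simp
  then have "el8 w a' s c' d' \<in> P"
    using prime_P[of "1 + (w + w ^ 7)" "el8 w a' s c' d'"] False w by (auto intro!: closed_R el8_R)
  moreover have "norm8 a' s c' d' = int p"
    using norm norm8_seven[of a' c' s d'] unfolding eqs by simp
  ultimately show ?thesis by blast
qed

text \<open>The norm vanishes modulo 7, so one of the four linear forms does. Rewriting the same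
  element of \<open>P\<close> in terms of \<open>- w\<close>, \<open>w ^ 3\<close> or
  \<open>- (w ^ 3)\<close> carries each form to the first one.\<close>

lemma el8_descent_seven:
  assumes w: "w \<in> R" "w ^ 8 = -1" and p: "p mod 16 = 7"
    and el: "el8 w a b c d \<in> P" and norm: "norm8 a b c d = 7 * int p"
  shows "\<exists>a b c d. el8 w a b c d \<in> P \<and> norm8 a b c d = int p"
proof -
  let ?u = "w ^ 3"
  have inv: "norm8 a b (- c) (- d) = norm8 a b c d" "norm8 a (- b) (- d) c = norm8 a b c d"
    "norm8 a (- b) d (- c) = norm8 a b c d" for a b c d
    by (simp_all add: norm8_def quad8_def bil8_def power2_eq_square algebra_simps)
  have w': "- w \<in> R" "(- w) ^ 8 = -1" "?u \<in> R" "?u ^ 8 = -1" "- ?u \<in> R" "(- ?u) ^ 8 = -1"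
  proof -
    have "?u ^ 8 = (w ^ 8) ^ 3" by (simp flip: power_mult)
    then show "?u ^ 8 = -1" "(- ?u) ^ 8 = -1" using w by simp_all
  qed (use w in \<open>auto intro!: closed_R\<close>)
  have "7 dvd norm8 a b c d" using norm by simp
  then have "7 dvd (a + 3 * b - c + 3 * d) * (a + 3 * b + c - 3 * d)
      * ((a - 3 * b - d - 3 * c) * (a - 3 * b + d + 3 * c))"
    using dvd_diff[OF _ norm8_mod_seven, of "norm8 a b c d" a b c d]
    by (simp only: diff_diff_eq2 add_diff_cancel_left')
  moreover have "prime (7 :: int)" by simp
  ultimately consider "7 dvd a + 3 * b - c + 3 * d" | "7 dvd a + 3 * b + c - 3 * d"
    | "7 dvd a - 3 * b - d - 3 * c" | "7 dvd a - 3 * b + d + 3 * c"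
    by (auto simp: prime_dvd_mult_iff)
  then show ?thesis
  proof cases
    case 1
    then show ?thesis by (rule el8_descent_seven_aux[OF w p el norm])
  next
    case 2
    have "\<exists>a b c d. el8 (- w) a b c d \<in> P \<and> norm8 a b c d = int p"
    proof (rule el8_descent_seven_aux[OF w'(1,2) p])
      show "el8 (- w) a b (- c) (- d) \<in> P" using el by (simp add: el8_uminus[OF w(2)])
      show "norm8 a b (- c) (- d) = 7 * int p" using norm by (simp add: inv)
      show "7 dvd a + 3 * b - - c + 3 * - d" using 2 by simp
    qed
    then show ?thesis unfolding el8_uminus[OF w(2)] by (metis inv(1))
  next
    case 3
    have "\<exists>a b c d. el8 ?u a b c d \<in> P \<and> norm8 a b c d = int p"
    proof (rule el8_descent_seven_aux[OF w'(3,4) p])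
      show "el8 ?u a (- b) d (- c) \<in> P" using el by (simp add: el8_cube[OF w(2)])
      show "norm8 a (- b) d (- c) = 7 * int p" using norm by (simp add: inv)
      show "7 dvd a + 3 * - b - d + 3 * - c" using 3 by simp
    qed
    then show ?thesis unfolding el8_cube[OF w(2)] by (metis inv(2))
  next
    case 4
    have "\<exists>a b c d. el8 (- ?u) a b c d \<in> P \<and> norm8 a b c d = int p"
    proof (rule el8_descent_seven_aux[OF w'(5,6) p])
      show "el8 (- ?u) a (- b) (- d) c \<in> P" using el by (simp add: el8_uminus[OF w'(4)] el8_cube[OF w(2)])
      show "norm8 a (- b) (- d) c = 7 * int p" using norm by (simp add: inv)
      show "7 dvd a + 3 * - b - - d + 3 * c" using 4 by simp
    qed
    then show ?thesis unfolding el8_uminus[OF w'(4)] el8_cube[OF w(2)] by (metis inv)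
  qed
qed

lemma exists_el8_norm_p:
  assumes w: "w \<in> R" "w ^ 8 = -1" and p: "p mod 16 = 7"
  shows "\<exists>a b c d. el8 w a b c d \<in> P \<and> norm8 a b c d = int p"
proof -
  have odd: "odd p" using p by presburger
  have p0: "int p > 0" using p by (cases "p = 0") auto
  have two: "\<exists>a b c d. el8 w a b c d \<in> P \<and> norm8 a b c d = k * int p"
    if "\<exists>a b c d. el8 w a b c d \<in> P \<and> norm8 a b c d = (2 * k) * int p" for k
    using that el8_descent_two[OF w odd, where k = "k * int p"] by (metis mult.assoc)
  \<comment> \<open>For weight 2 the Minkowski condition is
    \<open>64 * sqrt 2 < 10 * pi\<^sup>2\<close>, about 90.5 against 98.7, so the cofactor
    \<open>k\<close> is below 10.\<close>
  have "(sqrt 2) ^ 3 = 2 * sqrt 2" by (simp add: power3_eq_cube)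
  moreover have "sqrt 2 < 1.42" by (rule real_less_lsqrt) (simp_all add: power2_eq_square)
  ultimately have "32 * sqrt (real_of_int 2) ^ 3 < 3.14\<^sup>2 * real_of_int 10" by (simp add: power2_eq_square)
  also have "\<dots> \<le> pi\<^sup>2 * real_of_int 10"
    using pi_approx by (intro mult_right_mono power_mono) auto
  finally have "\<exists>a b c d. el8 w a b c d \<in> P \<and> a\<^sup>2 + 2 * (b\<^sup>2 + c\<^sup>2 + d\<^sup>2) > 0
      \<and> (a\<^sup>2 + 2 * (b\<^sup>2 + c\<^sup>2 + d\<^sup>2))\<^sup>2 < 10 * int p"
    by (intro short_quadruple el8_diff el8_R el8_frobenius w p) auto
  then obtain a b c d where el: "el8 w a b c d \<in> P"
    and q: "quad8 a b c d > 0" "(quad8 a b c d)\<^sup>2 < 10 * int p"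
    unfolding quad8_def by blast
  obtain k where "norm8 a b c d = int p * k" using el8_norm_dvd[OF w p el] by (rule dvdE)
  then have k: "norm8 a b c d = k * int p" by simp
  have "norm8 a b c d \<le> (quad8 a b c d)\<^sup>2" by (simp add: norm8_def)
  then have "k * int p < 10 * int p" using q(2) unfolding k by linarith
  moreover have "0 < k * int p" using norm8_pos[OF q(1)] unfolding k .
  ultimately have "0 < k" "k < 10"
    using p0 by (simp_all only: mult_less_cancel_right_pos zero_less_mult_pos2)
  \<comment> \<open>Powers of 2 and the value 7 are removed by descent; 3, 5 and 6 contain an inert
    prime exactly once.\<close>
  then have cases: "k = 1 \<or> k = 2 \<or> k = 4 \<or> k = 8 \<or> k = 7 \<or> k = 9 \<or> k = 3 \<or> k = 6 \<or> k = 5" by linarith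
  have el_k: "\<exists>a b c d. el8 w a b c d \<in> P \<and> norm8 a b c d = k * int p" using el k by blast
  have excl: False if "q = 3 \<or> q = 5" "q dvd k" "\<not> q\<^sup>2 dvd k" for q
    using norm_multiple_excluded[OF _ that, of "quad8 a b c d" "bil8 a b c d"] k p by (simp add: norm8_def)
  from cases show ?thesis
  proof (elim disjE)
    assume "k = 1"
    then show ?thesis using el_k by simp
  next
    assume "k = 2"
    then show ?thesis using two[of 1] el_k by simp
  next
    assume "k = 4"
    then show ?thesis using two[of 1] two[of 2] el_k by simp
  next
    assume "k = 8"
    then show ?thesis using two[of 1] two[of 2] two[of 4] el_k by simp
  next
    assume "k = 7"
    then show ?thesis using el8_descent_seven[OF w p el] k by simp
  next
    \<comment> \<open>The square 9 is not ruled out over \<open>\<rat>(\<surd>2)\<close>; but 3 is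
      inert in the quartic field too, so 81 divides the norm and 3 would divide
      \<open>p\<close>.\<close>
    assume k9: "k = 9"
    then have "3 dvd norm8 a b c d" using k by simp
    from norm8_inert_three[OF this] obtain a' b' c' d' where
      eqs: "a = 3 * a'" "b = 3 * b'" "c = 3 * c'" "d = 3 * d'" by (auto elim!: dvdE)
    have "norm8 a b c d = 81 * norm8 a' b' c' d'"
      unfolding eqs by (simp add: norm8_def quad8_def bil8_def power2_eq_square algebra_simps)
    then have "int p = 3 * (3 * norm8 a' b' c' d')" using k k9 by simp
    then have "3 dvd int p" by (rule dvdI)
    then show ?thesis using p_not_small[of 3] p by simp
  next
    assume "k = 3"
    then show ?thesis using excl[of 3] by simp
  next
    assume "k = 6"
    then show ?thesis using excl[of 3] by simp
  next
    assume "k = 5"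
    then show ?thesis using excl[of 5] by simp
  qed
qed

text \<open>The pairs \<open>(A, B)\<close> of elements of \<open>P\<close> of norm \<open>p\<close>
  form a nonempty set, stable under multiplying the element by
  \<open>1 \<plusminus> \<surd>2\<close>, so \<open>a_p_attained\<close> applies.\<close>

lemma exists_el4_quad_a_p:
  assumes w: "w \<in> R" "w ^ 4 = -1" and p: "p mod 16 = 9"
  shows "\<exists>a b c d. el4 w a b c d \<in> P \<and> quad4 a b c d = a_p (int p) \<and> norm4 a b c d = int p"
proof -
  define S where "S = {(x, y). \<exists>a b c d. el4 w a b c d \<in> P \<and> norm4 a b c d = int p
    \<and> quad4 a b c d = x \<and> bil4 a b c d = y}"
  have p0: "int p > 0" using p by (cases "p = 0") auto
  have "\<exists>y. (a_p (int p), y) \<in> S"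
  proof (rule a_p_attained)
    show "prime (int p)" "odd (int p)" using prime_p p by (simp, presburger)
    show "x > 0 \<and> x\<^sup>2 - 2 * y\<^sup>2 = int p" if "(x, y) \<in> S" for x y
      using that p0 quad4_pos_if by (fastforce simp: S_def norm4_def)
    show "S \<noteq> {}" using exists_el4_norm_p[OF w p] by (auto simp: S_def)
    fix x y assume "(x, y) \<in> S"
    then obtain a b c d where v: "el4 w a b c d \<in> P" "norm4 a b c d = int p"
      "x = quad4 a b c d" "y = bil4 a b c d" by (auto simp: S_def)
    have "(w - w ^ 3) * el4 w a b c d \<in> P"
      using v(1) w(1) by (intro mult_P) (auto intro!: closed_R)
    then have s: "el4 w (b - d) (a + c) (b + d) (c - a) \<in> P" by (simp only: el4_sqrt2[OF w(2)])
    have "el4 w (a + (b - d)) (b + (a + c)) (c + (b + d)) (d + (c - a)) \<in> P"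
      using v(1) s by (simp only: el4_add add_P)
    moreover have "norm4 (a + (b - d)) (b + (a + c)) (c + (b + d)) (d + (c - a)) = int p"
      using v(2) by (simp only: norm4_def pell_step4 pell_step_norm)
    ultimately show "(3 * x + 4 * y, 3 * y + 2 * x) \<in> S"
      unfolding S_def v(3,4) using pell_step4(1,2)[where a = a and b = b and c = c and d = d] by blast
    have "el4 w (a - (b - d)) (b - (a + c)) (c - (b + d)) (d - (c - a)) \<in> P"
      using v(1) s by (simp only: el4_diff diff_P)
    moreover have "norm4 (a - (b - d)) (b - (a + c)) (c - (b + d)) (d - (c - a)) = int p"
      using v(2) by (simp only: norm4_def pell_step4 pell_step_norm)
    ultimately show "(3 * x - 4 * y, 3 * y - 2 * x) \<in> S"
      unfolding S_def v(3,4) using pell_step4(3,4)[where a = a and b = b and c = c and d = d] by blast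
  qed
  then show ?thesis by (auto simp: S_def)
qed

lemma exists_el8_quad_a_p:
  assumes w: "w \<in> R" "w ^ 8 = -1" and p: "p mod 16 = 7"
  shows "\<exists>a b c d. el8 w a b c d \<in> P \<and> quad8 a b c d = a_p (int p) \<and> norm8 a b c d = int p"
proof -
  define S where "S = {(x, y). \<exists>a b c d. el8 w a b c d \<in> P \<and> norm8 a b c d = int p
    \<and> quad8 a b c d = x \<and> bil8 a b c d = y}"
  have p0: "int p > 0" using p by (cases "p = 0") auto
  have "\<exists>y. (a_p (int p), y) \<in> S"
  proof (rule a_p_attained)
    show "prime (int p)" "odd (int p)" using prime_p p by (simp, presburger)
    show "x > 0 \<and> x\<^sup>2 - 2 * y\<^sup>2 = int p" if "(x, y) \<in> S" for x y
      using that p0 quad8_pos_if by (fastforce simp: S_def norm8_def)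
    show "S \<noteq> {}" using exists_el8_norm_p[OF w p] by (auto simp: S_def)
    fix x y assume "(x, y) \<in> S"
    then obtain a b c d where v: "el8 w a b c d \<in> P" "norm8 a b c d = int p"
      "x = quad8 a b c d" "y = bil8 a b c d" by (auto simp: S_def)
    have "(w ^ 2 - w ^ 6) * el8 w a b c d \<in> P"
      using v(1) w(1) by (intro mult_P) (auto intro!: closed_R)
    then have s: "el8 w (2 * b) a (d - c) (c + d) \<in> P" by (simp only: el8_sqrt2[OF w(2)])
    have "el8 w (a + 2 * b) (b + a) (c + (d - c)) (d + (c + d)) \<in> P"
      using v(1) s by (simp only: el8_add add_P)
    moreover have "norm8 (a + 2 * b) (b + a) (c + (d - c)) (d + (c + d)) = int p"
      using v(2) by (simp only: norm8_def pell_step8 pell_step_norm)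
    ultimately show "(3 * x + 4 * y, 3 * y + 2 * x) \<in> S"
      unfolding S_def v(3,4) using pell_step8(1,2)[where a = a and b = b and c = c and d = d] by blast
    have "el8 w (a - 2 * b) (b - a) (c - (d - c)) (d - (c + d)) \<in> P"
      using v(1) s by (simp only: el8_diff diff_P)
    moreover have "norm8 (a - 2 * b) (b - a) (c - (d - c)) (d - (c + d)) = int p"
      using v(2) by (simp only: norm8_def pell_step8 pell_step_norm)
    ultimately show "(3 * x - 4 * y, 3 * y - 2 * x) \<in> S"
      unfolding S_def v(3,4) using pell_step8(3,4)[where a = a and b = b and c = c and d = d] by blast
  qed
  then show ?thesis by (auto simp: S_def)
qed

end

section \<open>The cyclotomic integers of 2-power order\<close>

text \<open>Evaluating at the indeterminate reduces the coefficients, so over \<open>bit\<close> it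
  gives the reduction modulo 2.\<close>

lemma coeff_ipoly_indeterminate: "coeff (ipoly f [:0, 1 :: 'a :: comm_ring_1:]) i = of_int (coeff f i)"
proof (induction f arbitrary: i)
  case (pCons a f)
  have "coeff (of_int a :: 'a poly) i = (if i = 0 then of_int a else 0)"
    by (simp add: of_int_poly coeff_pCons split: nat.split)
  then show ?case using pCons
    by (cases i) (simp_all add: ipoly_pCons del: map_poly_pCons)
qed simp

lemma of_int_bit_odd: "odd k \<Longrightarrow> (of_int k :: bit) = 1"
proof -
  assume "odd k"
  then obtain j where "k = 2 * j + 1" by (rule oddE)
  moreover have "of_int (2 * j) = (of_int j + of_int j :: bit)" by (simp only: mult_2 of_int_add)
  moreover have "c + c = 0" for c :: bit by (cases c) simp_all
  ultimately show ?thesis by (simp only: of_int_add of_int_1 add_0)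
qed

lemma freshman_bit_poly: "(f + 1) ^ (2 ^ n) = (f :: bit poly) ^ (2 ^ n) + 1"
proof (induction n)
  case (Suc n)
  have "c + c = 0" for c :: bit by (cases c) simp_all
  then have two: "g + g = 0" for g :: "bit poly" by (intro poly_eqI) (simp only: coeff_add coeff_0)
  have "(f + 1) ^ (2 ^ Suc n) = ((f + 1) ^ (2 ^ n))\<^sup>2"
    by (simp add: power_mult mult.commute[of 2])
  also have "\<dots> = f ^ (2 ^ Suc n) + 1 + (f ^ (2 ^ n) + f ^ (2 ^ n))"
    unfolding Suc by (simp add: power2_eq_square algebra_simps flip: power_add mult_2)
  finally show ?case by (simp add: two)
qed simp

lemma dvd_cancel_coprime:
  fixes x :: "'a :: comm_ring_1"
  assumes "1 = g - x * s" "g dvd x * y"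
  shows "g dvd y"
proof -
  have "1 * y = (g - x * s) * y" by (rule arg_cong[OF assms(1)])
  then have "y = g * y - x * y * s" by (simp add: algebra_simps)
  moreover have "g dvd g * y - x * y * s" using assms(2) by (intro dvd_diff) auto
  ultimately show ?thesis by (simp only:)
qed

text \<open>Modulo 2, \<open>X\<^bsup>N\<^esup> + 1\<close> is the \<open>N\<close>-th power of \<open>X + 1\<close>, as in Eisenstein's criterion.\<close>

lemma even_factor_at_1:
  fixes g h :: "int poly"
  assumes gh: "g * h = monom 1 (2 ^ n) + 1" and deg: "degree g > 0"
  shows "even (poly g 1)"
proof (rule ccontr)
  assume odd: "odd (poly g 1)"
  define X :: "bit poly" where "X = [:0, 1:]"
  define G where "G = ipoly g X"
  have X1: "X + 1 = [:- 1, 1:]" by (simp add: X_def one_pCons)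
  have "G * ipoly h X = ipoly (monom 1 (2 ^ n) + 1) X"
    by (simp add: G_def flip: gh ipoly_mult)
  also have "\<dots> = X ^ (2 ^ n) + 1"
    by (simp add: ipoly_add ipoly_monom)
  finally have GX: "G dvd (X + 1) ^ (2 ^ n)"
    unfolding freshman_bit_poly by (metis dvd_triv_left)
  have "poly (ipoly f X) 1 = of_int (poly f 1)" for f
  proof (induction f)
    case (pCons a f)
    have "poly (of_int a) 1 = (of_int a :: bit)" "poly X 1 = 1"
      by (simp_all only: of_int_poly X_def) simp_all
    then show ?case
      by (simp only: ipoly_pCons pCons poly_add poly_mult poly_pCons of_int_add mult_1)
  qed simp
  then have "poly G 1 = 1" by (simp only: G_def of_int_bit_odd[OF odd])
  then have "G = (X + 1) * synthetic_div G 1 + 1"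
    using synthetic_div_correct'[of 1 G] by (simp only: X1 flip: one_pCons)
  \<comment> \<open>A Bezout relation: \<open>G\<close> takes the value 1 at 1, hence is coprime to
    \<open>X + 1\<close> and must be a unit when it divides a power of \<open>X + 1\<close>.\<close>
  then have K: "1 = G - (X + 1) * synthetic_div G 1" by (simp add: algebra_simps)
  have cancel: "G dvd y" if "G dvd (X + 1) * y" for y
    using K that by (rule dvd_cancel_coprime)
  have "G dvd (X + 1) ^ k \<Longrightarrow> G dvd 1" for k
  proof (induction k)
    case (Suc k)
    then show ?case using cancel[of "(X + 1) ^ k"] by (simp only: power_Suc)
  qed simp
  with GX have "G dvd 1" by blast
  then have "degree G = 0" by (auto simp only: is_unit_poly_iff degree_pCons_0)
  \<comment> \<open>The leading coefficient of \<open>g\<close> divides 1, so the degree does not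
    drop modulo 2.\<close>
  moreover have "coeff G (degree g) = 1"
  proof -
    have "degree (monom 1 (2 ^ n) + 1 :: int poly) = 2 ^ n"
      by (subst degree_add_eq_left) (auto simp: degree_monom_eq)
    then have "lead_coeff (g * h) = 1" by (simp add: gh)
    then have "lead_coeff g dvd 1" unfolding lead_coeff_mult by (metis dvd_triv_left)
    then have "odd (lead_coeff g)" by (meson dvd_trans odd_one)
    from of_int_bit_odd[OF this] show ?thesis by (simp only: G_def X_def coeff_ipoly_indeterminate)
  qed
  ultimately show False using deg by (simp add: coeff_eq_0)
qed

text \<open>Irreducibility of \<open>X^N + 1\<close> for \<open>N = 2^n\<close>: a least-degree
  annihilator of \<open>w\<close> would yield a proper factorisation over the integers. Both factors
  are even at 1, whereas \<open>X^N + 1\<close> takes the value 2 there.\<close>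

lemma ipoly_root_of_minus_one_nonzero:
  fixes w :: "'a :: {field_char_0}" and f :: "int poly"
  assumes w: "w ^ (2 ^ n) = -1" and f: "f \<noteq> 0" "degree f < 2 ^ n"
  shows "ipoly f w \<noteq> 0"
proof
  assume "ipoly f w = 0"
  define F :: "int poly" where "F = monom 1 (2 ^ n) + 1"
  have degF: "degree F = 2 ^ n"
    unfolding F_def by (subst degree_add_eq_left) (auto simp: degree_monom_eq)
  have Fw: "ipoly F w = 0" by (simp add: F_def ipoly_add ipoly_monom w)
  define Z where "Z = {f :: int poly. f \<noteq> 0 \<and> ipoly f w = 0}"
  have "f \<in> Z" using f \<open>ipoly f w = 0\<close> by (simp add: Z_def)
  then obtain g where g: "g \<in> Z" and min: "\<And>h. h \<in> Z \<Longrightarrow> degree g \<le> degree h"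
    using ex_has_least_nat[of "\<lambda>f. f \<in> Z" f degree] by blast
  have "degree g < 2 ^ n" using min[OF \<open>f \<in> Z\<close>] f by simp
  have "g \<noteq> 0" using g by (simp add: Z_def)
  from pseudo_mod[OF this, of F] obtain a q where
    aq: "a \<noteq> 0" "Polynomial.smult a F = g * q + pseudo_mod F g"
    and r: "pseudo_mod F g = 0 \<or> degree (pseudo_mod F g) < degree g" by blast
  have "ipoly (Polynomial.smult a F) w = ipoly g w * ipoly q w + ipoly (pseudo_mod F g) w"
    unfolding aq by (simp only: ipoly_add ipoly_mult)
  then have "ipoly (pseudo_mod F g) w = 0" using g by (simp add: ipoly_smult Fw Z_def)
  then have "pseudo_mod F g = 0 \<or> pseudo_mod F g \<in> Z" unfolding Z_def by blast
  then have "pseudo_mod F g = 0" using min[of "pseudo_mod F g"] r by linarith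
  then have aF: "Polynomial.smult a F = g * q" using aq by simp
  \<comment> \<open>Gauss's lemma: \<open>F\<close> is primitive, so after passing to primitive
    parts the constant \<open>a\<close> cancels up to sign.\<close>
  define G where "G = primitive_part g"
  have degG: "degree G = degree g" by (simp add: G_def)
  define q' where "q' = Polynomial.smult (Polynomial.content g) q"
  have aF': "Polynomial.smult a F = G * q'"
    unfolding aF q'_def G_def by (metis content_times_primitive_part mult_smult_left mult_smult_right)
  have "Polynomial.content F dvd coeff F (2 ^ n)" by (rule content_dvd_coeff)
  then have "Polynomial.content F dvd 1" by (simp add: F_def)
  then have "Polynomial.content F = 1" by (metis is_unit_content_iff)
  moreover have "Polynomial.content G = 1" using \<open>g \<noteq> 0\<close> by (simp add: G_def)
  ultimately have "Polynomial.content q' = \<bar>a\<bar>" using arg_cong[OF aF', of Polynomial.content] by (simp add: content_mult)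
  then have "q' = Polynomial.smult \<bar>a\<bar> (primitive_part q')" by (metis content_times_primitive_part)
  then have "Polynomial.smult \<bar>a\<bar> (G * primitive_part q') = Polynomial.smult \<bar>a\<bar> (Polynomial.smult (sgn a) F)"
    using aF' by (metis mult_smult_right smult_smult abs_mult_sgn)
  then have "G * primitive_part q' = Polynomial.smult (sgn a) F"
    using \<open>a \<noteq> 0\<close> by (metis abs_eq_0 smult_cancel)
  then have "G * Polynomial.smult (sgn a) (primitive_part q') = Polynomial.smult (sgn a * sgn a) F"
    by (metis mult_smult_right smult_smult)
  also have "sgn a * sgn a = 1" using \<open>a \<noteq> 0\<close> by (simp add: sgn_if)
  finally obtain H where GH: "G * H = F" by (metis smult_1_left)
  have "G \<noteq> 0" "H \<noteq> 0" using GH degF by auto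
  then have "degree G + degree H = 2 ^ n" using GH degF by (metis degree_mult_eq)
  then have "degree H > 0" using degG \<open>degree g < 2 ^ n\<close> by simp
  have "degree G > 0"
  proof (rule ccontr)
    assume "\<not> degree G > 0"
    then have "degree g = 0" using degG by simp
    then obtain c where "g = [:c:]" by (metis degree_eq_zeroE)
    then show False using g by (simp add: Z_def ipoly_pCons del: map_poly_pCons)
  qed
  have "even (poly G 1)" using even_factor_at_1[OF GH[unfolded F_def] \<open>degree G > 0\<close>] .
  moreover have "even (poly H 1)"
    using even_factor_at_1[of H G n] GH \<open>degree H > 0\<close> by (simp add: F_def mult.commute)
  ultimately have "2 * 2 dvd poly G 1 * poly H 1" by (rule mult_dvd_mono)
  also have "poly G 1 * poly H 1 = 2"
    by (simp only: GH flip: poly_mult) (simp add: F_def poly_monom)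
  finally show False by simp
qed

text \<open>All roots of \<open>X^N + 1\<close> are conjugate: the pseudo-remainder by
  \<open>F\<close> vanishes at \<open>w\<close> and has too small a degree to be nonzero. This makes
  \<open>cyc_emb\<close> well defined.\<close>

lemma ipoly_root_of_minus_one_transfer:
  fixes w v :: "'a :: {field_char_0}" and f :: "int poly"
  assumes w: "w ^ (2 ^ n) = -1" and v: "v ^ (2 ^ n) = -1" and f: "ipoly f w = 0"
  shows "ipoly f v = 0"
proof -
  define F :: "int poly" where "F = monom 1 (2 ^ n) + 1"
  have degF: "degree F = 2 ^ n"
    unfolding F_def by (subst degree_add_eq_left) (auto simp: degree_monom_eq)
  then have "F \<noteq> 0" by auto
  have F: "ipoly F w = 0" "ipoly F v = 0"
    using w v by (simp_all add: F_def ipoly_add ipoly_monom)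
  from pseudo_mod[OF \<open>F \<noteq> 0\<close>, of f] obtain a q where
    aq: "a \<noteq> 0" "Polynomial.smult a f = F * q + pseudo_mod f F"
    and r: "pseudo_mod f F = 0 \<or> degree (pseudo_mod f F) < degree F" by blast
  have eq: "of_int a * ipoly f x = ipoly F x * ipoly q x + ipoly (pseudo_mod f F) x" for x :: 'a
    using arg_cong[OF aq(2), of "\<lambda>f. ipoly f x"] by (simp only: ipoly_add ipoly_mult ipoly_smult)
  have "ipoly (pseudo_mod f F) w = 0" using eq[of w] F f by simp
  then have "pseudo_mod f F = 0" using ipoly_root_of_minus_one_nonzero[OF w] r degF by metis
  then show ?thesis using eq[of v] F aq(1) by simp
qed

section \<open>Coefficients, embeddings and lengths of cyclotomic integers\<close>

lemma zeta_power: "zeta m ^ k = cis (2 * pi * real k / real m)"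
  by (simp add: zeta_def Complex.DeMoivre mult_ac)

lemma zeta_power_minus_one: "zeta (2 ^ (n + 1)) ^ (2 ^ n) = -1"
  by (simp add: zeta_power)

lemma zeta_in_cyc_int: "zeta m \<in> cyc_int m"
proof -
  have "zeta m = ipoly [:0, 1:] (zeta m)" by (simp add: ipoly_pCons del: map_poly_pCons)
  then show ?thesis unfolding cyc_int_def by blast
qed

lemma cyc_int_closed:
  shows "1 \<in> cyc_int m"
    and "x \<in> cyc_int m \<Longrightarrow> y \<in> cyc_int m \<Longrightarrow> x + y \<in> cyc_int m"
    and "x \<in> cyc_int m \<Longrightarrow> - x \<in> cyc_int m"
    and "x \<in> cyc_int m \<Longrightarrow> y \<in> cyc_int m \<Longrightarrow> x * y \<in> cyc_int m"
proof -
  show "1 \<in> cyc_int m" unfolding cyc_int_def by (simp, rule exI[of _ 1], simp)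
  show "x + y \<in> cyc_int m" if "x \<in> cyc_int m" "y \<in> cyc_int m"
    using that unfolding cyc_int_def by (auto simp flip: ipoly_add)
  show "- x \<in> cyc_int m" if "x \<in> cyc_int m"
  proof -
    obtain f where "x = ipoly f (zeta m)" using \<open>x \<in> cyc_int m\<close> by (auto simp: cyc_int_def)
    then have "- x = ipoly (Polynomial.smult (-1) f) (zeta m)" by (simp add: ipoly_smult del: smult_minus_left)
    then show ?thesis unfolding cyc_int_def by blast
  qed
  show "x * y \<in> cyc_int m" if "x \<in> cyc_int m" "y \<in> cyc_int m"
    using that unfolding cyc_int_def by (auto simp flip: ipoly_mult)
qed

lemma ipoly_reduce:
  fixes w :: "'a :: comm_ring_1"
  assumes w: "w ^ N = -1" and N: "N > 0"
  shows "\<exists>c. ipoly f w = (\<Sum>i<N. of_int (c i) * w ^ i)"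
proof (induction f)
  case 0
  then show ?case by (auto intro!: exI[of _ "\<lambda>_. 0"])
next
  case (pCons a f)
  then obtain c where c: "ipoly f w = (\<Sum>i<N. of_int (c i) * w ^ i)" by blast
  obtain M where M: "N = Suc M" using N by (cases N) auto
  \<comment> \<open>Multiplication by \<open>w\<close> shifts the coefficients, and the top one
    re-enters at position 0 with its sign changed.\<close>
  define d where "d i = (case i of 0 \<Rightarrow> a - c M | Suc i \<Rightarrow> c i)" for i
  have "ipoly (pCons a f) w = of_int a + (\<Sum>i<M. of_int (c i) * w ^ Suc i) + of_int (c M) * w ^ N"
    by (simp add: ipoly_pCons c M sum_distrib_left algebra_simps del: map_poly_pCons)
  also have "\<dots> = of_int (d 0) + (\<Sum>i<M. of_int (d (Suc i)) * w ^ Suc i)"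
    unfolding w by (simp add: d_def)
  also have "\<dots> = (\<Sum>i<N. of_int (d i) * w ^ i)"
    unfolding M sum.lessThan_Suc_shift by simp
  finally show ?case by blast
qed

lemma cyc_int_pow2_conv: "cyc_int (2 ^ (n + 1)) = {\<Sum>i<2 ^ n. of_int (c i) * zeta (2 ^ (n + 1)) ^ i | c. True}"
proof (intro equalityI subsetI)
  fix x assume "x \<in> cyc_int (2 ^ (n + 1))"
  then obtain f where f: "x = ipoly f (zeta (2 ^ (n + 1)))" by (auto simp: cyc_int_def)
  show "x \<in> {\<Sum>i<2 ^ n. of_int (c i) * zeta (2 ^ (n + 1)) ^ i | c. True}"
    using ipoly_reduce[OF zeta_power_minus_one[of n], of f] unfolding f by simp
next
  fix x assume "x \<in> {\<Sum>i<2 ^ n. of_int (c i) * zeta (2 ^ (n + 1)) ^ i | c. True}"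
  then obtain c where x: "x = (\<Sum>i<2 ^ n. of_int (c i) * zeta (2 ^ (n + 1)) ^ i)" by blast
  have "ipoly (\<Sum>i<k. monom (c i) i) w = (\<Sum>i<k. of_int (c i) * w ^ i)" for k and w :: complex
    by (induction k) (simp_all add: ipoly_add ipoly_monom)
  then show "x \<in> cyc_int (2 ^ (n + 1))" unfolding cyc_int_def x by (auto intro: exI sym)
qed

lemma ipoly_sum_monom: "ipoly (\<Sum>i<k. monom (c i) i) w = (\<Sum>i<k. of_int (c i) * w ^ i)"
  by (induction k) (simp_all add: ipoly_add ipoly_monom)

text \<open>For odd \<open>k\<close> the power \<open>zeta ^ k\<close> is again a root of
  \<open>X^N + 1\<close>, so the value in \<open>cyc_emb\<close> does not depend on the chosen
  polynomial.\<close>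

lemma cyc_emb_sum:
  fixes c :: "nat \<Rightarrow> int"
  defines "z \<equiv> \<lambda>n. zeta (2 ^ (n + 1))"
  assumes k: "odd k"
  shows "cyc_emb (2 ^ (n + 1)) k (\<Sum>i<2 ^ n. of_int (c i) * z n ^ i) = (\<Sum>i<2 ^ n. of_int (c i) * (z n ^ k) ^ i)"
  unfolding cyc_emb_def
proof (rule the_equality)
  have z: "z n ^ (2 ^ n) = -1" unfolding z_def by (rule zeta_power_minus_one)
  have zk: "(z n ^ k) ^ (2 ^ n) = -1"
    using z k by (simp add: mult.commute[of k] power_mult flip: power_mult[of _ k])
  let ?c = "\<Sum>i<2 ^ n. monom (c i) i"
  show ex: "\<exists>f. (\<Sum>i<2 ^ n. of_int (c i) * z n ^ i) = ipoly f (zeta (2 ^ (n + 1))) \<and>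
      (\<Sum>i<2 ^ n. of_int (c i) * (z n ^ k) ^ i) = ipoly f (zeta (2 ^ (n + 1)) ^ k)"
    by (rule exI[of _ ?c]) (simp add: ipoly_sum_monom z_def)
  fix y assume "\<exists>f. (\<Sum>i<2 ^ n. of_int (c i) * z n ^ i) = ipoly f (zeta (2 ^ (n + 1))) \<and>
      y = ipoly f (zeta (2 ^ (n + 1)) ^ k)"
  then obtain f where f: "ipoly ?c (z n) = ipoly f (z n)" "y = ipoly f (z n ^ k)"
    by (auto simp: ipoly_sum_monom z_def)
  have diff: "ipoly (f + Polynomial.smult (- 1) ?c) x = ipoly f x - ipoly ?c x" for x :: complex
    by (simp only: ipoly_add ipoly_smult) simp
  have "ipoly (f + Polynomial.smult (- 1) ?c) (z n) = 0" unfolding diff f by simp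
  from ipoly_root_of_minus_one_transfer[OF z zk this]
  have "ipoly f (z n ^ k) = ipoly ?c (z n ^ k)" unfolding diff by simp
  then show "y = (\<Sum>i<2 ^ n. of_int (c i) * (z n ^ k) ^ i)" by (simp only: f ipoly_sum_monom)
qed

lemma zeta_square_power_ne_1:
  assumes "0 < d" "d < 2 ^ n"
  shows "zeta (2 ^ (n + 1)) ^ (2 * d) \<noteq> 1"
proof
  assume "zeta (2 ^ (n + 1)) ^ (2 * d) = 1"
  then have "cos (2 * pi * (real d / 2 ^ n)) = 1"
    by (simp add: zeta_power complex_eq_iff mult_ac)
  then obtain j :: int where "2 * pi * (real d / 2 ^ n) = of_int j * 2 * pi"
    by (auto simp: cos_one_2pi_int)
  then have "real d = of_int j * 2 ^ n" by (simp add: field_simps)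
  then have "int d = j * 2 ^ n"
    by (metis of_int_eq_iff of_int_mult of_int_numeral of_int_of_nat_eq of_int_power)
  then have "2 ^ n dvd d" by (metis dvd_triv_right int_dvd_int_iff of_nat_numeral of_nat_power)
  then show False using assms by (auto dest: dvd_imp_le)
qed

text \<open>Orthogonality: with \<open>e = z ^ (i - j)\<close> the sum is \<open>e\<close> times a
  geometric series in \<open>e\<^sup>2\<close>, whose \<open>2 ^ n\<close>-th power is 1 and which
  differs from 1 for distinct \<open>i\<close> and \<open>j\<close>.\<close>

lemma zeta_odd_power_sum:
  fixes n i j :: nat
  defines "z \<equiv> zeta (2 ^ (n + 1))"
  assumes ij: "i < 2 ^ n" "j < 2 ^ n"
  shows "(\<Sum>l<2 ^ n. (z ^ (2 * l + 1)) ^ i * cnj ((z ^ (2 * l + 1)) ^ j)) = (if i = j then 2 ^ n else 0)"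
proof -
  have cnj_z: "z * cnj z = 1" unfolding z_def zeta_def by (simp add: cis_cnj cis_mult)
  define e where "e = z ^ i * cnj z ^ j"
  have pow: "(z ^ k) ^ i * cnj ((z ^ k) ^ j) = e ^ k" for k
    by (simp add: e_def power_mult_distrib mult.commute flip: power_mult)
  have "(\<Sum>l<2 ^ n. (z ^ (2 * l + 1)) ^ i * cnj ((z ^ (2 * l + 1)) ^ j)) = e * (\<Sum>l<2 ^ n. (e\<^sup>2) ^ l)"
    unfolding pow by (simp add: sum_distrib_left flip: power_mult)
  also have "\<dots> = (if i = j then 2 ^ n else 0)"
  proof (cases "i = j")
    case True
    then have "e = 1" by (simp add: e_def cnj_z flip: power_mult_distrib)
    then show ?thesis using True by simp
  next
    case False
    have red: "z ^ (k + d) * cnj z ^ k = z ^ d" for k d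
    proof -
      have "z ^ (k + d) * cnj z ^ k = (z * cnj z) ^ k * z ^ d"
        by (simp add: power_add power_mult_distrib mult_ac)
      then show ?thesis by (simp add: cnj_z)
    qed
    have "e\<^sup>2 \<noteq> 1"
    proof (cases "j < i")
      case True
      then have "e = z ^ (i - j)" using red[of j "i - j"] by (simp add: e_def)
      then have "e\<^sup>2 = z ^ (2 * (i - j))" by (simp add: mult.commute flip: power_mult)
      then show ?thesis using zeta_square_power_ne_1[of "i - j" n] True ij by (simp add: z_def)
    next
      case False
      then have "cnj e = z ^ (j - i)" using red[of i "j - i"] \<open>i \<noteq> j\<close> by (simp add: e_def mult.commute)
      then have "cnj (e\<^sup>2) = z ^ (2 * (j - i))" by (simp add: mult.commute flip: power_mult)
      moreover have "z ^ (2 * (j - i)) \<noteq> 1"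
        using zeta_square_power_ne_1[of "j - i" n] False \<open>i \<noteq> j\<close> ij by (simp add: z_def)
      ultimately show ?thesis by (metis complex_cnj_one)
    qed
    moreover have "(e\<^sup>2) ^ (2 ^ n) = 1"
    proof -
      have "z ^ (2 ^ n) = -1" unfolding z_def by (rule zeta_power_minus_one)
      moreover from this have "cnj z ^ (2 ^ n) = -1" by (metis complex_cnj_minus complex_cnj_one complex_cnj_power)
      moreover have "(e\<^sup>2) ^ (2 ^ n) = ((z ^ (2 ^ n)) ^ i * (cnj z ^ (2 ^ n)) ^ j)\<^sup>2"
        by (simp add: e_def power_mult_distrib mult_ac flip: power_mult)
      ultimately show ?thesis by (simp add: power2_eq_square flip: power_add power_mult_distrib)
    qed
    ultimately have "(\<Sum>l<2 ^ n. (e\<^sup>2) ^ l) = 0" by (simp add: geometric_sum)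
    then show ?thesis using False by simp
  qed
  finally show ?thesis .
qed

text \<open>Parseval's identity: the embeddings are indexed by the odd numbers
  \<open>2 * l + 1\<close>, and orthogonality kills the mixed terms.\<close>

lemma canon_norm_sum:
  fixes c :: "nat \<Rightarrow> int"
  shows "canon_norm (2 ^ (n + 1)) (\<Sum>i<2 ^ n. of_int (c i) * zeta (2 ^ (n + 1)) ^ i)
     = sqrt (2 ^ n * real_of_int (\<Sum>i<2 ^ n. (c i)\<^sup>2))"
proof -
  define z where "z = zeta (2 ^ (n + 1))"
  define S where "S l = (\<Sum>i<2 ^ n. of_int (c i) * (z ^ (2 * l + 1)) ^ i)" for l
  let ?f = "\<lambda>k. (cmod (cyc_emb (2 ^ (n + 1)) k (\<Sum>i<2 ^ n. of_int (c i) * z ^ i)))\<^sup>2"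
  have "cyc_emb_index (2 ^ (n + 1)) = (\<lambda>l. 2 * l + 1) ` {..<2 ^ n}"
    by (auto simp: cyc_emb_index_def image_iff elim!: oddE)
  then have "sum ?f (cyc_emb_index (2 ^ (n + 1))) = (\<Sum>l<2 ^ n. ?f (2 * l + 1))"
    by (simp add: sum.reindex inj_on_def)
  also have "\<dots> = (\<Sum>l<2 ^ n. (cmod (S l))\<^sup>2)"
    unfolding z_def S_def by (intro sum.cong refl) (subst cyc_emb_sum, simp_all)
  finally have 1: "sum ?f (cyc_emb_index (2 ^ (n + 1))) = (\<Sum>l<2 ^ n. (cmod (S l))\<^sup>2)" .
  have "complex_of_real (\<Sum>l<2 ^ n. (cmod (S l))\<^sup>2) = (\<Sum>l<2 ^ n. S l * cnj (S l))"
    by (simp only: of_real_sum complex_norm_square)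
  also have "\<dots> = (\<Sum>l<2 ^ n. \<Sum>i<2 ^ n. \<Sum>j<2 ^ n.
      of_int (c i * c j) * ((z ^ (2 * l + 1)) ^ i * cnj ((z ^ (2 * l + 1)) ^ j)))"
    by (simp add: S_def sum_product mult_ac)
  also have "\<dots> = (\<Sum>i<2 ^ n. \<Sum>l<2 ^ n. \<Sum>j<2 ^ n. of_int (c i * c j) * ((z ^ (2 * l + 1)) ^ i * cnj ((z ^ (2 * l + 1)) ^ j)))"
    by (rule sum.swap)
  also have "\<dots> = (\<Sum>i<2 ^ n. \<Sum>j<2 ^ n. \<Sum>l<2 ^ n. of_int (c i * c j) * ((z ^ (2 * l + 1)) ^ i * cnj ((z ^ (2 * l + 1)) ^ j)))"
    by (rule sum.cong[OF refl], rule sum.swap)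
  also have "\<dots> = (\<Sum>i<2 ^ n. \<Sum>j<2 ^ n. of_int (c i * c j) *
      (\<Sum>l<2 ^ n. ((z ^ (2 * l + 1)) ^ i * cnj ((z ^ (2 * l + 1)) ^ j))))"
    by (simp only: sum_distrib_left)
  also have "\<dots> = (\<Sum>i<2 ^ n. \<Sum>j<2 ^ n. of_int (c i * c j) * (if i = j then 2 ^ n else 0))"
    unfolding z_def by (intro sum.cong refl arg_cong2[of _ _ _ _ "(*)"] zeta_odd_power_sum) auto
  also have "\<dots> = (\<Sum>i<2 ^ n. of_int (c i * c i) * 2 ^ n)"
    by (simp add: if_distrib[of "(*) _"] cong: if_cong)
  also have "\<dots> = complex_of_real (2 ^ n * real_of_int (\<Sum>i<2 ^ n. (c i)\<^sup>2))"
    by (simp add: sum_distrib_left power2_eq_square mult_ac)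
  finally have "(\<Sum>l<2 ^ n. (cmod (S l))\<^sup>2) = 2 ^ n * real_of_int (\<Sum>i<2 ^ n. (c i)\<^sup>2)"
    by (simp only: of_real_eq_iff)
  then show ?thesis unfolding canon_norm_def using 1 by (simp add: z_def)
qed

section \<open>Shortest vectors\<close>

lemma sum_residue_blocks:
  fixes f :: "nat \<Rightarrow> 'b :: comm_monoid_add"
  shows "(\<Sum>i<K * M. f i) = (\<Sum>j<K. \<Sum>i<M. f (j + K * i))"
proof -
  have "(\<Sum>i<M * K. f i) = (\<Sum>m<M. sum f {m * K..<m * K + K})"
    by (rule sum.nat_group[symmetric])
  also have "\<dots> = (\<Sum>m<M. \<Sum>j<K. f (j + K * m))"
  proof (rule sum.cong[OF refl])
    fix m
    show "sum f {m * K..<m * K + K} = (\<Sum>j<K. f (j + K * m))"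
      using sum.shift_bounds_nat_ivl[of f 0 "m * K" K]
      by (simp add: lessThan_atLeast0 add.commute mult.commute)
  qed
  finally show ?thesis by (subst sum.swap) (simp add: mult.commute)
qed

text \<open>Padding with zeros turns a short element of the subring generated by
  \<open>w ^ K\<close> into one of the full ring with the same sum of squares.\<close>

lemma spread_coefficients:
  fixes w :: "'a :: comm_ring_1" and l :: "nat \<Rightarrow> int"
  assumes "K > 0"
  shows "\<exists>c. (\<Sum>i<K * M. of_int (c i) * w ^ i) = (\<Sum>i<M. of_int (l i) * (w ^ K) ^ i)
    \<and> (\<Sum>i<K * M. (c i)\<^sup>2) = (\<Sum>i<M. (l i)\<^sup>2)"
proof -
  define c where "c i = (if i mod K = 0 then l (i div K) else 0)" for i
  have c: "c (j + K * i) = (if j = 0 then l i else 0)" if "j < K" for j i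
    using that by (simp add: c_def)
  have single: "(\<Sum>j<K. if j = 0 then g else 0) = g" for g :: "'b :: comm_monoid_add"
    using assms by simp
  have "(\<Sum>i<K * M. of_int (c i) * w ^ i) = (\<Sum>j<K. if j = 0 then \<Sum>i<M. of_int (l i) * (w ^ K) ^ i else 0)"
    unfolding sum_residue_blocks
    by (intro sum.cong refl) (auto simp: c power_mult intro!: sum.neutral)
  moreover have "(\<Sum>i<K * M. (c i)\<^sup>2) = (\<Sum>j<K. if j = 0 then \<Sum>i<M. (l i)\<^sup>2 else 0)"
    unfolding sum_residue_blocks
    by (intro sum.cong refl) (auto simp: c intro!: sum.neutral)
  ultimately show ?thesis unfolding single by blast
qed

lemma sum_squares_4: "(\<Sum>i<4. (c i)\<^sup>2) = sq4 c"
  by (simp add: sq4_def eval_nat_numeral)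

lemma sum_squares_8: "(\<Sum>i<8. (c i)\<^sup>2) = sq4 (\<lambda>i. c (2 * i)) + sq4 (\<lambda>i. c (1 + 2 * i))"
  by (simp add: sq4_def eval_nat_numeral)

context prime_ideal_over
begin

text \<open>Each block alone contributes an element \<open>A j + B j \<surd>2\<close> of
  \<open>P\<close>; their sum is in \<open>P\<close> as well, so \<open>p\<close> divides its
  norm.\<close>

lemma a_p_le_sum:
  assumes r: "r \<in> R" "r\<^sup>2 = 2"
    and AB: "\<And>j. j \<in> J \<Longrightarrow> of_int (A j) + of_int (B j) * r \<in> P"
    and A: "\<And>j. j \<in> J \<Longrightarrow> A j \<ge> 0" "\<And>j. j \<in> J \<Longrightarrow> 2 * (B j)\<^sup>2 \<le> (A j)\<^sup>2"
    and pos: "sum A J > 0" and ab: "a > 0" "a\<^sup>2 - 2 * b\<^sup>2 = int p"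
  shows "a_p (int p) \<le> sum A J"
proof (rule a_p_le_if_dvd[OF _ ab pos])
  show "prime (int p)" using prime_p by simp
  show "2 * (sum B J)\<^sup>2 \<le> (sum A J)\<^sup>2" using A by (rule double_square_le_sum)
  have "(\<Sum>j\<in>J. of_int (A j) + of_int (B j) * r) \<in> P" using AB by (rule sum_P)
  then have "of_int (sum A J) + of_int (sum B J) * r \<in> P"
    by (simp add: sum.distrib sum_distrib_right)
  then show "int p dvd (sum A J)\<^sup>2 - 2 * (sum B J)\<^sup>2" by (rule norm_form_in_P[OF r])
qed

lemma square_sum_minimum_9_mod_16:
  assumes w: "w \<in> R" "w ^ (2 ^ n) = -1" and p: "p mod 16 = 9" and n: "n \<ge> 2"
  shows "\<exists>c. (\<Sum>i<2 ^ n. of_int (c i) * w ^ i) \<in> P \<and> (\<Sum>i<2 ^ n. (c i)\<^sup>2) = a_p (int p)"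
    and "(\<Sum>i<2 ^ n. of_int (c i) * w ^ i) \<in> P \<Longrightarrow> (\<Sum>i<2 ^ n. (c i)\<^sup>2) > 0
      \<Longrightarrow> a_p (int p) \<le> (\<Sum>i<2 ^ n. (c i)\<^sup>2)"
    and "\<exists>b. a_p (int p) > 0 \<and> (a_p (int p))\<^sup>2 - 2 * b\<^sup>2 = int p"
proof -
  define s where "s = n - 2"
  have n_s: "n = s + 2" using n by (simp add: s_def)
  have N: "2 ^ n = 2 ^ s * (4 :: nat)" by (simp add: n_s power_add)
  have K0: "(2 :: nat) ^ s > 0" by simp
  define v where "v = w ^ (2 ^ s)"
  have v: "v \<in> R" "v ^ 4 = -1"
    using w unfolding N by (simp_all add: v_def power_R power_mult)
  obtain x y z u where el: "el4 v x y z u \<in> P" "quad4 x y z u = a_p (int p)" "norm4 x y z u = int p"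
    using exists_el4_quad_a_p[OF v p] by blast
  have p0: "int p > 0" using p by (cases "p = 0") auto
  have ap: "a_p (int p) > 0" using quad4_pos_if[of x y z u] el p0 by simp
  have ap2: "(a_p (int p))\<^sup>2 - 2 * (bil4 x y z u)\<^sup>2 = int p"
    using el(3) unfolding norm4_def el(2) .
  show "\<exists>b. a_p (int p) > 0 \<and> (a_p (int p))\<^sup>2 - 2 * b\<^sup>2 = int p" using ap ap2 by blast
  obtain d where "(\<Sum>i<2 ^ s * 4. of_int (d i) * w ^ i) = (\<Sum>i<4. of_int ([x, y, z, u] ! i) * (w ^ (2 ^ s)) ^ i)"
    "(\<Sum>i<2 ^ s * 4. (d i)\<^sup>2) = (\<Sum>i<4. ([x, y, z, u] ! i)\<^sup>2)"
    using spread_coefficients[OF K0, where M = 4 and w = w and l = "(!) [x, y, z, u]"] by blast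
  then show "\<exists>c. (\<Sum>i<2 ^ n. of_int (c i) * w ^ i) \<in> P \<and> (\<Sum>i<2 ^ n. (c i)\<^sup>2) = a_p (int p)"
    using el(1,2) unfolding N sum_squares_4 quad4_conv el4_conv_sum v_def by metis
  \<comment> \<open>\<open>p - 1\<close> is 8 times an odd number, so \<open>block_split\<close>
    applies with \<open>e = 3\<close> to Frobenius itself and leaves blocks of length 4.\<close>
  define l where "l = 1 + 2 * (p div 16)"
  have l: "p = 1 + 2 ^ 3 * l" "odd l" using p by (simp_all add: l_def, presburger)
  have odd_p: "odd p" using p by presburger
  assume c: "(\<Sum>i<2 ^ n. of_int (c i) * w ^ i) \<in> P" "(\<Sum>i<2 ^ n. (c i)\<^sup>2) > 0"
  have sum_eq: "(\<Sum>i<2 ^ n. (c i)\<^sup>2) = (\<Sum>j<2 ^ s. sq4 (\<lambda>i. c (j + 2 ^ s * i)))"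
    unfolding N sum_residue_blocks by (simp only: sum_squares_4)
  show "a_p (int p) \<le> (\<Sum>i<2 ^ n. (c i)\<^sup>2)"
    unfolding sum_eq
  proof (rule a_p_le_sum[where r = "v - v ^ 3" and B = "\<lambda>j. cross4 (\<lambda>i. c (j + 2 ^ s * i))"])
    show "v - v ^ 3 \<in> R" using v by (auto intro!: closed_R)
    show "(v - v ^ 3)\<^sup>2 = 2" using v(2) by (rule sqrt2_cyclotomic8)
    have wN: "w ^ (2 ^ (s + 3 - 1)) = -1" using w(2) by (simp add: n_s add.commute)
    have cP: "(\<Sum>i<2 ^ s * 4. of_int (c i) * w ^ i) \<in> P" using c(1) unfolding N .
    fix j :: nat assume "j \<in> {..<2 ^ s}"
    then have "(\<Sum>i<4. of_int (c (j + 2 ^ s * i)) * (w ^ (2 ^ s)) ^ i) \<in> P"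
      by (intro block_split[where t = 1 and q = p, OF _ l _ odd_p w(1) wN cP]) simp_all
    then show "of_int (sq4 (\<lambda>i. c (j + 2 ^ s * i))) + of_int (cross4 (\<lambda>i. c (j + 2 ^ s * i))) * (v - v ^ 3) \<in> P"
      unfolding v_def[symmetric] by (rule block4_in_P[OF v])
  qed (use c(2) ap ap2 sum_eq in \<open>simp_all add: sq4_nonneg cross4_bound\<close>)
qed

lemma square_sum_minimum_7_mod_16:
  assumes w: "w \<in> R" "w ^ (2 ^ n) = -1" and p: "p mod 16 = 7" and n: "n \<ge> 3"
  shows "\<exists>c. (\<Sum>i<2 ^ n. of_int (c i) * w ^ i) \<in> P \<and> (\<Sum>i<2 ^ n. (c i)\<^sup>2) = a_p (int p)"
    and "(\<Sum>i<2 ^ n. of_int (c i) * w ^ i) \<in> P \<Longrightarrow> (\<Sum>i<2 ^ n. (c i)\<^sup>2) > 0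
      \<Longrightarrow> a_p (int p) \<le> (\<Sum>i<2 ^ n. (c i)\<^sup>2)"
    and "\<exists>b. a_p (int p) > 0 \<and> (a_p (int p))\<^sup>2 - 2 * b\<^sup>2 = int p"
proof -
  define s where "s = n - 3"
  have n_s: "n = s + 3" using n by (simp add: s_def)
  have N: "2 ^ n = 2 ^ s * (8 :: nat)" by (simp add: n_s power_add)
  have K0: "(2 :: nat) ^ s > 0" by simp
  define v where "v = w ^ (2 ^ s)"
  have v: "v \<in> R" "v ^ 8 = -1"
    using w unfolding N by (simp_all add: v_def power_R power_mult)
  obtain x y z u where el: "el8 v x y z u \<in> P" "quad8 x y z u = a_p (int p)" "norm8 x y z u = int p"
    using exists_el8_quad_a_p[OF v p] by blast
  have p0: "int p > 0" using p by (cases "p = 0") auto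
  have ap: "a_p (int p) > 0" using quad8_pos_if[of x y z u] el p0 by simp
  have ap2: "(a_p (int p))\<^sup>2 - 2 * (bil8 x y z u)\<^sup>2 = int p"
    using el(3) unfolding norm8_def el(2) .
  show "\<exists>b. a_p (int p) > 0 \<and> (a_p (int p))\<^sup>2 - 2 * b\<^sup>2 = int p" using ap ap2 by blast
  have quad: "(\<Sum>i<8. ([x, z, y, u, 0, u, - y, z] ! i)\<^sup>2) = quad8 x y z u"
    by (simp add: quad8_def eval_nat_numeral)
  obtain d where "(\<Sum>i<2 ^ s * 8. of_int (d i) * w ^ i) = (\<Sum>i<8. of_int ([x, z, y, u, 0, u, - y, z] ! i) * (w ^ (2 ^ s)) ^ i)"
    "(\<Sum>i<2 ^ s * 8. (d i)\<^sup>2) = (\<Sum>i<8. ([x, z, y, u, 0, u, - y, z] ! i)\<^sup>2)"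
    using spread_coefficients[OF K0, where M = 8 and w = w and l = "(!) [x, z, y, u, 0, u, - y, z]"] by blast
  then show "\<exists>c. (\<Sum>i<2 ^ n. of_int (c i) * w ^ i) \<in> P \<and> (\<Sum>i<2 ^ n. (c i)\<^sup>2) = a_p (int p)"
    using el(1,2) unfolding N quad el8_conv_sum[OF v(2)] v_def[symmetric] by metis
  define k where "k = p div 16"
  have pk: "p = 16 * k + 7" using p by (simp add: k_def, presburger)
  \<comment> \<open>\<open>p ^ 2 - 1\<close> is 16 times an odd number, so
    \<open>block_split\<close> applies with \<open>e = 4\<close> to the square of Frobenius and
    leaves blocks of length 8.\<close>
  define l where "l = 16 * k\<^sup>2 + 14 * k + 3"
  have l: "p ^ 2 = 1 + 2 ^ 4 * l" "odd l" by (simp_all add: l_def pk power2_eq_square algebra_simps)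
  have odd_p: "odd p" using p by presburger
  assume c: "(\<Sum>i<2 ^ n. of_int (c i) * w ^ i) \<in> P" "(\<Sum>i<2 ^ n. (c i)\<^sup>2) > 0"
  let ?e = "\<lambda>j i. c (j + 2 ^ s * (2 * i))" and ?f = "\<lambda>j i. c (j + 2 ^ s * (1 + 2 * i))"
  have sum_eq: "(\<Sum>i<2 ^ n. (c i)\<^sup>2) = (\<Sum>j<2 ^ s. sq4 (?e j) + sq4 (?f j))"
    unfolding N sum_residue_blocks by (simp only: sum_squares_8)
  show "a_p (int p) \<le> (\<Sum>i<2 ^ n. (c i)\<^sup>2)"
    unfolding sum_eq
  proof (rule a_p_le_sum[where r = "v\<^sup>2 - (v\<^sup>2) ^ 3" and B = "\<lambda>j. cross4 (?e j) + cross4 (?f j)"])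
    show "v\<^sup>2 - (v\<^sup>2) ^ 3 \<in> R" using v by (auto intro!: closed_R)
    show "(v\<^sup>2 - (v\<^sup>2) ^ 3)\<^sup>2 = 2" using v(2) by (intro sqrt2_cyclotomic8) (simp flip: power_mult)
    show "2 * (cross4 (?e j) + cross4 (?f j))\<^sup>2 \<le> (sq4 (?e j) + sq4 (?f j))\<^sup>2" for j
      by (intro double_square_le_add sq4_nonneg cross4_bound)
    have wN: "w ^ (2 ^ (s + 4 - 1)) = -1" using w(2) by (simp add: n_s add.commute)
    have cP: "(\<Sum>i<2 ^ s * 8. of_int (c i) * w ^ i) \<in> P" using c(1) unfolding N .
    fix j :: nat assume "j \<in> {..<2 ^ s}"
    then have "(\<Sum>i<8. of_int (c (j + 2 ^ s * i)) * (w ^ (2 ^ s)) ^ i) \<in> P"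
      by (intro block_split[where t = 2 and q = "p ^ 2", OF _ l _ odd_p w(1) wN cP]) simp_all
    then show "of_int (sq4 (?e j) + sq4 (?f j)) + of_int (cross4 (?e j) + cross4 (?f j)) * (v\<^sup>2 - (v\<^sup>2) ^ 3) \<in> P"
      unfolding v_def[symmetric] by (rule block8_in_P[OF v _ p])
  qed (use c(2) ap ap2 sum_eq in \<open>simp_all add: sq4_nonneg\<close>)
qed

end

section \<open>Numerical bounds and the shortest vector\<close>

lemma sqrt_le_fourth_root:
  fixes a p :: real
  assumes "a \<ge> 0" "a\<^sup>2 \<le> 2 * p"
  shows "sqrt (2 ^ n * a) \<le> (2 ^ (2 * n + 1) * p) powr (1 / 4)"
proof -
  have "sqrt (2 ^ n * a) = ((2 ^ n * a)\<^sup>2) powr (1 / 4)"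
  proof -
    have "((2 ^ n * a)\<^sup>2) powr (1 / 4) = ((2 ^ n * a) powr 2) powr (1 / 4)"
      using assms(1) by (simp add: powr_numeral)
    also have "\<dots> = (2 ^ n * a) powr (1 / 2)" by (simp add: powr_powr)
    also have "\<dots> = sqrt (2 ^ n * a)" using assms(1) by (simp add: powr_half_sqrt)
    finally show ?thesis ..
  qed
  also have "\<dots> \<le> (2 ^ (2 * n + 1) * p) powr (1 / 4)"
  proof (rule powr_mono2)
    have "(2 ^ n * a)\<^sup>2 = 2 ^ (2 * n) * a\<^sup>2" by (simp add: power_mult_distrib power_mult mult.commute flip: power_mult)
    also have "\<dots> \<le> 2 ^ (2 * n) * (2 * p)" using assms(2) by (intro mult_left_mono) auto
    finally show "(2 ^ n * a)\<^sup>2 \<le> 2 ^ (2 * n + 1) * p" by (simp add: mult_ac)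
  qed simp_all
  finally show ?thesis .
qed

text \<open>After cancelling \<open>p\<close>, this is \<open>2 * n + 1 < 4 * n\<close>.\<close>

lemma fourth_root_less_minkowski:
  fixes p :: real
  assumes "p > 0" "n > 0"
  shows "(2 ^ (2 * n + 1) * p) powr (1 / 4) < 2 ^ n * p powr (1 / 4)"
proof -
  have "(2 ^ (2 * n + 1) * p) powr (1 / 4) < (2 ^ (4 * n) * p) powr (1 / 4)"
  proof (rule powr_less_mono2)
    have "(2 :: real) ^ (2 * n + 1) < 2 ^ (4 * n)" using assms(2) by (intro power_strict_increasing) auto
    then show "2 ^ (2 * n + 1) * p < 2 ^ (4 * n) * p" using assms(1) by simp
  qed (use assms in simp_all)
  also have "\<dots> = (2 ^ (4 * n)) powr (1 / 4) * p powr (1 / 4)" using assms by (simp add: powr_mult)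
  also have "(2 ^ (4 * n) :: real) powr (1 / 4) = 2 ^ n"
  proof -
    have "(2 ^ (4 * n) :: real) powr (1 / 4) = (2 powr real (4 * n)) powr (1 / 4)" by (simp only: powr_realpow)
    also have "\<dots> = 2 powr real n" by (simp add: powr_powr)
    also have "\<dots> = 2 ^ n" by (simp add: powr_realpow)
    finally show ?thesis .
  qed
  finally show ?thesis .
qed

theorem theorem2:
  fixes p :: int and n :: nat and P :: "complex set"
  assumes "prime p"
    and "p mod 16 = 7 \<or> p mod 16 = 9"
    and "p mod 16 = 7 \<Longrightarrow> n \<ge> 3"
    and "p mod 16 = 9 \<Longrightarrow> n \<ge> 2"
    and "lies_over (2 ^ (n + 1)) P p"
  shows "lambda1 (2 ^ (n + 1)) P = sqrt (2 ^ n * real_of_int (a_p p))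
       \<and> lambda1 (2 ^ (n + 1)) P \<le> (2 ^ (2 * n + 1) * real_of_int p) powr (1 / 4)
       \<and> (2 ^ (2 * n + 1) * real_of_int p) powr (1 / 4) < 2 ^ n * real_of_int p powr (1 / 4)"
proof -
  let ?m = "2 ^ (n + 1)"
  define q where "q = nat p"
  have p0: "p > 0" using assms(1) prime_gt_0_int by blast
  then have q: "int q = p" by (simp add: q_def)
  have ideal: "cyc_ideal ?m P" "P \<noteq> cyc_int ?m" "of_int p \<in> P"
    and prime: "\<And>a b. a \<in> cyc_int ?m \<Longrightarrow> b \<in> cyc_int ?m \<Longrightarrow> a * b \<in> P \<Longrightarrow> a \<in> P \<or> b \<in> P"
    using assms(5) by (auto simp: lies_over_def cyc_prime_ideal_def)
  interpret prime_ideal_over "cyc_int ?m" P q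
  proof
    show "1 \<notin> P"
    proof
      assume "1 \<in> P"
      then have "cyc_int ?m \<subseteq> P" using ideal(1) unfolding cyc_ideal_def by (metis mult.right_neutral subsetI)
      then show False using ideal(1,2) unfolding cyc_ideal_def by blast
    qed
    show "prime q" using assms(1) p0 by (simp add: q_def prime_nat_iff_prime)
    show "of_nat q \<in> P" using ideal(3) by (metis of_int_of_nat_eq q)
  qed (use ideal(1) prime in \<open>auto simp: cyc_int_closed cyc_ideal_def\<close>)
  let ?w = "zeta ?m"
  have w: "?w \<in> cyc_int ?m" "?w ^ (2 ^ n) = -1" by (rule zeta_in_cyc_int, rule zeta_power_minus_one)
  have q_mod: "(q mod 16 = 7 \<and> n \<ge> 3) \<or> (q mod 16 = 9 \<and> n \<ge> 2)"
  proof -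
    have "p mod 16 = int (q mod 16)" unfolding q[symmetric] by (simp only: zmod_int of_nat_numeral)
    then have "p mod 16 = 7 \<longleftrightarrow> q mod 16 = 7" "p mod 16 = 9 \<longleftrightarrow> q mod 16 = 9" by linarith+
    then show ?thesis using assms(2-4) by blast
  qed
  have *: "(\<exists>c. (\<Sum>i<2 ^ n. of_int (c i) * ?w ^ i) \<in> P \<and> (\<Sum>i<2 ^ n. (c i)\<^sup>2) = a_p p)
    \<and> (\<forall>c. (\<Sum>i<2 ^ n. of_int (c i) * ?w ^ i) \<in> P \<longrightarrow> (\<Sum>i<2 ^ n. (c i)\<^sup>2) > 0
        \<longrightarrow> a_p p \<le> (\<Sum>i<2 ^ n. (c i)\<^sup>2))
    \<and> (\<exists>b. a_p p > 0 \<and> (a_p p)\<^sup>2 - 2 * b\<^sup>2 = p)"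
    using q_mod
  proof (elim disjE conjE)
    assume "q mod 16 = 7" "n \<ge> 3"
    from square_sum_minimum_7_mod_16[OF w this, unfolded q] show ?thesis by (intro conjI allI impI)
  next
    assume "q mod 16 = 9" "n \<ge> 2"
    from square_sum_minimum_9_mod_16[OF w this, unfolded q] show ?thesis by (intro conjI allI impI)
  qed
  then have lower: "\<And>c. (\<Sum>i<2 ^ n. of_int (c i) * ?w ^ i) \<in> P \<Longrightarrow> (\<Sum>i<2 ^ n. (c i)\<^sup>2) > 0
      \<Longrightarrow> a_p p \<le> (\<Sum>i<2 ^ n. (c i)\<^sup>2)" by blast
  obtain b where ap: "a_p p > 0" "(a_p p)\<^sup>2 - 2 * b\<^sup>2 = p" using * by blast
  have eq: "lambda1 ?m P = sqrt (2 ^ n * real_of_int (a_p p))"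
    unfolding lambda1_def
  proof (rule cInf_eq_minimum)
    obtain c where c: "(\<Sum>i<2 ^ n. of_int (c i) * ?w ^ i) \<in> P" "(\<Sum>i<2 ^ n. (c i)\<^sup>2) = a_p p"
      using * by blast
    have norm: "canon_norm ?m (\<Sum>i<2 ^ n. of_int (c i) * ?w ^ i) = sqrt (2 ^ n * real_of_int (a_p p))"
      by (simp only: canon_norm_sum c(2))
    \<comment> \<open>The minimiser has positive length and is therefore nonzero.\<close>
    have "canon_norm ?m 0 = 0" using canon_norm_sum[of n "\<lambda>_. 0"] by simp
    then have "(\<Sum>i<2 ^ n. of_int (c i) * ?w ^ i) \<noteq> 0" using norm ap(1) by auto
    then show "sqrt (2 ^ n * real_of_int (a_p p)) \<in> canon_norm ?m ` (P - {0})"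
      using c(1) norm by (intro image_eqI[where x = "\<Sum>i<2 ^ n. of_int (c i) * ?w ^ i"]) auto
  next
    fix y assume "y \<in> canon_norm ?m ` (P - {0})"
    then obtain x where x: "x \<in> P" "x \<noteq> 0" "y = canon_norm ?m x" by blast
    have "x \<in> cyc_int ?m" using x(1) by (rule P_R)
    then obtain c where c: "x = (\<Sum>i<2 ^ n. of_int (c i) * ?w ^ i)"
      unfolding cyc_int_pow2_conv by blast
    have "\<exists>i<2 ^ n. c i \<noteq> 0"
    proof (rule ccontr)
      assume "\<not> ?thesis"
      then have "x = 0" unfolding c by (intro sum.neutral) auto
      then show False using x(2) by simp
    qed
    then have "(\<Sum>i<2 ^ n. (c i)\<^sup>2) > 0" by (auto intro!: sum_pos2)
    then have "a_p p \<le> (\<Sum>i<2 ^ n. (c i)\<^sup>2)" using lower[of c] x(1) unfolding c by blast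
    then have "real_of_int (a_p p) \<le> real_of_int (\<Sum>i<2 ^ n. (c i)\<^sup>2)" by (simp only: of_int_le_iff)
    then show "sqrt (2 ^ n * real_of_int (a_p p)) \<le> y"
      unfolding x(3) c canon_norm_sum by (intro real_sqrt_le_mono mult_left_mono) auto
  qed
  have "(a_p p)\<^sup>2 \<le> 2 * p" using a_p_square_le[OF assms(1) ap] .
  then have "real_of_int ((a_p p)\<^sup>2) \<le> real_of_int (2 * p)" by (simp only: of_int_le_iff)
  then have "sqrt (2 ^ n * real_of_int (a_p p)) \<le> (2 ^ (2 * n + 1) * real_of_int p) powr (1 / 4)"
    using ap(1) by (intro sqrt_le_fourth_root) auto
  moreover have "n > 0" using q_mod by auto
  then have "(2 ^ (2 * n + 1) * real_of_int p) powr (1 / 4) < 2 ^ n * real_of_int p powr (1 / 4)"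
    using p0 by (intro fourth_root_less_minkowski) auto
  ultimately show ?thesis unfolding eq by blast
qed

end
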